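(* For each $b\in\Gamma:=\{3\}\cup\bigcup_{k=1}^\infty \{k^2+1,\dots,k^2+k\}$, the set $T_b$ of Trott numbers in base $b$ is a complete $G_\delta$ set; that is, $T_b$ is a $G_\delta$ subset of $\mathbb{R}$ but not an $F_\sigma$ set.
   Context: Let $b\geq 2$ be an integer. A real number $x$ is a Trott number in base $b$ if $x\in(0,1)$ has an infinite continued fraction expansion $x=[0;a_1,a_2,a_3,\dots]$ with all $a_i$ positive integers, and the base-$b$ expansion of $x$ is $x=(0.\hat{a}_1\hat{a}_2\hat{a}_3\dots)_b$, where $\hat{a}_i$ denotes the string of base-$b$ digits of $a_i$ (without leading zeros) and the strings are concatenated. $T_b$ denotes the set of Trott numbers in base $b$. *)

theory Defs
  imports "HOL-Analysis.Analysis" "HOL-Library.Stream"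
begin

text \<open>
  The string of base-\<open>b\<close> digits of \<open>n\<close>, most significant digit first and without leading
  zeros. It is empty for \<open>n = 0\<close>; the guard \<open>b < 2\<close> only serves to make the function total.
\<close>

fun base_digits :: "nat \<Rightarrow> nat \<Rightarrow> nat list" where
  "base_digits b n = (if b < 2 \<or> n = 0 then [] else base_digits b (n div b) @ [n mod b])"

declare base_digits.simps [simp del]

lemma base_digits_value:
  assumes "b \<ge> 2"
  shows "foldl (\<lambda>v d. v * b + d) 0 (base_digits b n) = n"
  using assms by (induction b n rule: base_digits.induct) (subst base_digits.simps, auto)

lemma base_digits_less: "d \<in> set (base_digits b n) \<Longrightarrow> d < b"
proof (induction b n rule: base_digits.induct)
  case (1 b n)
  then show ?case by (subst (asm) (2) base_digits.simps) (auto split: if_splits)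
qed

lemma base_digits_nonempty: "b \<ge> 2 \<Longrightarrow> n > 0 \<Longrightarrow> base_digits b n \<noteq> []"
  by (subst base_digits.simps) auto

lemma hd_base_digits_pos: "b \<ge> 2 \<Longrightarrow> n > 0 \<Longrightarrow> hd (base_digits b n) > 0"
proof (induction b n rule: base_digits.induct)
  case (1 b n)
  show ?case
  proof (cases "n div b = 0")
    case True
    then have "n < b" using "1.prems" by (simp add: div_eq_0_iff)
    with True "1.prems" show ?thesis
      by (subst base_digits.simps) (simp add: base_digits.simps[of b 0])
  next
    case False
    with 1 have "hd (base_digits b (n div b)) > 0" by auto
    with False "1.prems" show ?thesis
      by (subst base_digits.simps) (simp add: hd_append base_digits_nonempty)
  qed
qed

text \<open>\<open>finite_cfrac [a\<^sub>1, \<dots>, a\<^sub>n]\<close> is the finite continued fraction \<open>[0; a\<^sub>1, \<dots>, a\<^sub>n]\<close>.\<close>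

fun finite_cfrac :: "nat list \<Rightarrow> real" where
  "finite_cfrac [] = 0"
| "finite_cfrac (a # as) = 1 / (real a + finite_cfrac as)"

text \<open>\<open>x = [0; a\<^sub>1, a\<^sub>2, \<dots>]\<close> with all partial quotients positive; the stream \<open>a\<close> starts
  with \<open>a\<^sub>1\<close>.\<close>

definition has_infinite_cfrac :: "real \<Rightarrow> nat stream \<Rightarrow> bool" where
  "has_infinite_cfrac x a \<longleftrightarrow>
     (\<forall>i. a !! i > 0) \<and> (\<lambda>n. finite_cfrac (stake n a)) \<longlonglongrightarrow> x"

text \<open>
  \<open>x = (0.d\<^sub>1 d\<^sub>2 d\<^sub>3 \<dots>)\<^sub>b\<close>. For rational \<open>x\<close> there may be two such digit streams, but an
  infinite continued fraction has an irrational value, so the base-\<open>b\<close> expansion of a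
  Trott number is unique.
\<close>

definition has_base_expansion :: "nat \<Rightarrow> real \<Rightarrow> nat stream \<Rightarrow> bool" where
  "has_base_expansion b x d \<longleftrightarrow>
     (\<forall>i. d !! i < b) \<and> (\<lambda>i. real (d !! i) / real b ^ Suc i) sums x"

definition trott_numbers :: "nat \<Rightarrow> real set" where
  "trott_numbers b =
     {x. 0 < x \<and> x < 1 \<and>
         (\<exists>a. has_infinite_cfrac x a \<and> has_base_expansion b x (flat (smap (base_digits b) a)))}"

definition trott_bases :: "nat set" where
  "trott_bases = {3} \<union> (\<Union>k\<in>{1..}. {k\<^sup>2 + 1..k\<^sup>2 + k})"

end

theory Submission
  imports Defs
begin

text \<open>
  Let \<open>w = [a\<^sub>1, \<dots>, a\<^sub>n]\<close> have convergent \<open>p/q\<close>, and let \<open>Y\<close> be the value of its \<open>m\<close> base-\<open>b\<close>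
  digits. If \<open>A = b\<^sup>m p - Y q\<close> lies strictly between \<open>q/b\<close> and \<open>q\<close>, then \<open>p/q\<close> itself starts with the digits
  of \<open>w\<close>, followed by a nonzero digit. A huge next term \<open>a\<close> with \<open>L\<close> digits keeps the new convergent
  within the new digit interval when \<open>a\<close> is the integer part of
  \<open>(A\<^sup>2 b\<^sup>L \<plusminus> b\<^sup>m)/(q A)\<close>, provided the fractional part exceeds \<open>1/b\<close>. Periodicity of powers of \<open>b\<close> modulo
  \<open>q A\<close> makes this possible for infinitely many \<open>L\<close> once it is possible late enough, and a condition
  on prime divisors of \<open>A\<close> guarantees that the process never stops. Hence a good prefix \<open>w\<close>
  extends to Trott numbers starting with arbitrarily large \<open>a\<close> after \<open>w\<close>, so \<open>p/q\<close> is a limit of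
  them. The prefix \<open>[k]\<close> for \<open>k\<^sup>2 + 1 \<le> b \<le> k\<^sup>2 + k\<close> and the prefix \<open>[1, 1]\<close> for \<open>b = 3\<close> can be
  continued to a good one.

  In the closure of the set of Trott numbers with all long prefixes good, the Trott numbers
  therefore form a dense \<open>G\<^sub>\<delta>\<close> set whose complement, which contains the rational convergents, is dense
  as well. By the Baire category theorem this set is not \<open>F\<^sub>\<sigma>\<close>.
\<close>

section \<open>Powers of the base\<close>

lemma eventually_less_power:
  fixes b c d :: int
  assumes "b \<ge> 2" "c > 0"
  shows "\<forall>\<^sub>F L in sequentially. d < c * b ^ L"
proof (rule eventually_sequentiallyI)
  fix L assume L: "nat \<bar>d\<bar> \<le> L"
  have "int L < 2 ^ L" using of_nat_less_two_power[of L] by simp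
  also have "(2::int) ^ L \<le> b ^ L" using assms by (intro power_mono) auto
  also have "1 * b ^ L \<le> c * b ^ L" using assms by (intro mult_right_mono) auto
  finally show "d < c * b ^ L" using L by linarith
qed

text \<open>A prime dividing \<open>b\<close> occurs in \<open>y\<close> fewer than \<open>i\<close>
  times, as \<open>y\<close> divides \<open>x\<close>, but at least \<open>i\<close> times in
  \<open>b ^ i\<close>. Any other prime cannot divide \<open>y\<close>, which divides a power of
  \<open>b\<close>.\<close>

lemma dvd_power_if_prime_powers_bounded:
  fixes b x y :: int
  assumes "b \<noteq> 0" "x \<noteq> 0" "y dvd x" "y dvd b ^ j"
    and prime_bound: "\<And>l. prime l \<Longrightarrow> l dvd b \<Longrightarrow> \<not> l ^ i dvd x"
  shows "y dvd b ^ i"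
proof (rule multiplicity_le_imp_dvd)
  show "y \<noteq> 0" using assms by auto
  fix l :: int assume l: "prime l"
  show "multiplicity l y \<le> multiplicity l (b ^ i)"
  proof (cases "l dvd b")
    case True
    then have "1 \<le> multiplicity l b"
      using l \<open>b \<noteq> 0\<close> by (intro multiplicity_geI) auto
    then have "i \<le> i * multiplicity l b" by simp
    moreover have "multiplicity l (b ^ i) = i * multiplicity l b"
      using l \<open>b \<noteq> 0\<close> by (intro prime_elem_multiplicity_power_distrib) auto
    moreover have "multiplicity l y < i"
    proof (rule ccontr)
      assume "\<not> multiplicity l y < i"
      then have "l ^ i dvd y" by (intro multiplicity_dvd') simp
      then have "l ^ i dvd x" using \<open>y dvd x\<close> by (rule dvd_trans)
      then show False using prime_bound[OF l True] by simp
    qed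
    ultimately show ?thesis by linarith
  next
    case False
    have "\<not> l dvd y"
    proof
      assume "l dvd y"
      then have "l dvd b ^ j" using \<open>y dvd b ^ j\<close> by (rule dvd_trans)
      then show False using prime_dvd_power[OF l] False by blast
    qed
    then show ?thesis by (simp add: not_dvd_imp_multiplicity_0)
  qed
qed

text \<open>The bound does not depend on \<open>L\<close>: the prime powers in question already divide \<open>F\<close>.\<close>

lemma smooth_divisor_of_shifted_power:
  fixes b E F y :: int
  assumes "b \<ge> 2" "F \<noteq> 0" "\<bar>F\<bar> < 2 ^ i" "i \<le> L" "b ^ L * E + F \<noteq> 0"
    and "y dvd b ^ L * E + F" "y dvd b ^ j"
  shows "y dvd b ^ i"
proof (rule dvd_power_if_prime_powers_bounded[OF _ assms(5-7)])
  fix l :: int assume l: "prime l" "l dvd b"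
  show "\<not> l ^ i dvd b ^ L * E + F"
  proof
    assume dvd: "l ^ i dvd b ^ L * E + F"
    have "l ^ i dvd b ^ L" using l \<open>i \<le> L\<close> by (intro dvd_power_le)
    then have "l ^ i dvd F" using dvd by (simp add: dvd_add_right_iff)
    then have "l ^ i \<le> \<bar>F\<bar>" using dvd_imp_le_int[OF \<open>F \<noteq> 0\<close>, of "l ^ i"] by linarith
    moreover have "(2::int) ^ i \<le> l ^ i" using l(1) by (intro power_mono) (auto simp: prime_ge_2_int)
    ultimately show False using assms(3) by linarith
  qed
qed (use \<open>b \<ge> 2\<close> in simp)

text \<open>By pigeonhole the powers are eventually periodic modulo \<open>Q\<close>. The hypothesis
  on divisors of \<open>Q\<close> bounds the preperiod by \<open>i\<close>, so that position
  \<open>i\<close> itself recurs.\<close>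

lemma powers_recur_mod:
  fixes b Q :: int
  assumes "Q > 0" and smooth: "\<And>y j. y dvd Q \<Longrightarrow> y dvd b ^ j \<Longrightarrow> y dvd b ^ i"
  obtains P where "P > 0" "\<And>n. Q dvd b ^ (i + n * P) - b ^ i"
proof -
  have "finite ((\<lambda>j. b ^ j mod Q) ` (UNIV :: nat set))"
  proof (rule finite_subset)
    show "(\<lambda>j. b ^ j mod Q) ` UNIV \<subseteq> {0..<Q}"
      using pos_mod_sign[OF \<open>Q > 0\<close>] pos_mod_bound[OF \<open>Q > 0\<close>] by auto
  qed simp
  then have "\<not> inj (\<lambda>j::nat. b ^ j mod Q)" using finite_imageD infinite_UNIV_nat by blast
  then obtain j j' :: nat where "j \<noteq> j'" "b ^ j mod Q = b ^ j' mod Q" by (auto simp: inj_def)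
  then obtain j1 j2 :: nat where j: "j1 < j2" "b ^ j2 mod Q = b ^ j1 mod Q"
    by (metis linorder_neq_iff)
  define P where "P = j2 - j1"
  have "P > 0" "j2 = j1 + P" using j by (auto simp: P_def)
  have "Q dvd b ^ j1 * (b ^ P - 1)"
    using j(2) unfolding \<open>j2 = _\<close> mod_eq_dvd_iff by (simp add: power_add algebra_simps)
  then have "Q dvd gcd (Q * (b ^ P - 1)) (b ^ j1 * (b ^ P - 1))" by simp
  also have "\<dots> dvd gcd Q (b ^ j1) * (b ^ P - 1)"
    by (simp only: gcd_mult_right gcd.commute[of "b ^ j1" Q] normalize_dvd_iff dvd_refl)
  also have "\<dots> dvd b ^ i * (b ^ P - 1)" by (intro mult_dvd_mono smooth[of _ j1]) auto
  finally have *: "Q dvd b ^ i * (b ^ P - 1)" .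
  have "Q dvd b ^ (i + n * P) - b ^ i" for n :: nat
  proof -
    have "b ^ P - 1 dvd (b ^ P) ^ n - 1" using power_diff_1_eq[of "b ^ P" n] by simp
    then have "b ^ i * (b ^ P - 1) dvd b ^ i * ((b ^ P) ^ n - 1)" by simp
    also have "b ^ i * ((b ^ P) ^ n - 1) = b ^ (i + n * P) - b ^ i"
      by (simp add: power_add right_diff_distrib mult.commute flip: power_mult)
    finally show ?thesis by (rule dvd_trans[OF *])
  qed
  then show thesis using that[of P] \<open>P > 0\<close> by simp
qed

section \<open>Choosing the next partial quotient\<close>

text \<open>
  Here \<open>r\<close> stands for the previous denominator, \<open>M\<close> for \<open>b\<^sup>m\<close> and \<open>e\<close> for \<open>(-1)\<^sup>n\<close>. The fourth conjunct
  excludes two degenerate values of the remainder \<open>R\<close> below; it holds automatically when the last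
  partial quotient is large. By the fifth conjunct, \<open>A\<close> has a prime factor not dividing \<open>b\<close>.
\<close>

definition extendable :: "int \<Rightarrow> int \<Rightarrow> int \<Rightarrow> int \<Rightarrow> int \<Rightarrow> int \<Rightarrow> bool" where
  "extendable b A q r M e \<longleftrightarrow>
     0 < q \<and> q < b * A \<and> A < q \<and> b * (A * r + M) \<le> q * A \<and> (\<forall>j. \<not> A dvd b ^ j) \<and>
     (\<exists>\<^sub>\<infinity>L. q * A < b * ((A\<^sup>2 * b ^ L + e * M) mod (q * A)))"

text \<open>\<open>X mod Z\<close> is \<open>Z\<close> times the fractional part of
  \<open>X / Z\<close>, so the residue condition in \<open>extendable\<close> can be verified by
  real estimates.\<close>

lemma less_mult_mod_if_between:
  fixes b X Z n :: int
  assumes "b > 0" "Z > 0" and lower: "n + 1 / b < X / Z" and upper: "X / Z < n + 1"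
  shows "Z < b * (X mod Z)"
proof -
  have "\<lfloor>real_of_int X / Z\<rfloor> = n"
  proof (rule floor_unique)
    have "0 < 1 / real_of_int b" using \<open>b > 0\<close> by simp
    then show "real_of_int n \<le> X / Z" using lower by linarith
  qed (use upper in simp)
  then have "X mod Z = X - Z * n"
    by (simp add: floor_divide_of_int_eq minus_mult_div_eq_mod [symmetric])
  moreover have "real_of_int Z < b * (X - Z * n)"
    using lower assms(1,2) by (simp add: field_simps)
  then have "Z < b * (X - Z * n)" by (metis of_int_less_iff of_int_mult of_int_diff)
  ultimately show ?thesis by simp
qed

lemma ex_power_scaling:
  fixes b y :: real
  assumes "b \<ge> 2" "0 < y" "y < 1"
  obtains i :: nat where "y * b ^ i < 1" "1 \<le> y * b ^ Suc i"
proof -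
  obtain n where "1 / y < b ^ n" using real_arch_pow[of b "1 / y"] assms by auto
  then have ex: "\<exists>n. 1 \<le> y * b ^ n" using assms by (intro exI[of _ n]) (simp add: field_simps)
  define k where "k = (LEAST n. 1 \<le> y * b ^ n)"
  have k: "1 \<le> y * b ^ k" unfolding k_def using ex by (rule LeastI_ex)
  then obtain i where i: "k = Suc i" using assms by (cases k) auto
  then have "y * b ^ i < 1" using not_less_Least[of i "\<lambda>n. 1 \<le> y * b ^ n"] by (simp add: k_def not_le)
  then show thesis using k unfolding i by (rule that)
qed

text \<open>Beyond position \<open>N\<close> a nonzero digit still occurs. Shifting it to the first
  place makes the fractional part at least \<open>1 / b\<close>; equality would terminate the
  expansion.\<close>

lemma ex_frac_gt_if_nonterminating:
  fixes b :: int and x :: real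
  assumes "b \<ge> 2" and nonterm: "\<And>j. x * of_int b ^ j \<notin> \<int>"
  obtains i where "N \<le> i" "\<lfloor>x * of_int b ^ i\<rfloor> + 1 / b < x * of_int b ^ i"
proof -
  define y where "y = frac (x * of_int b ^ N)"
  have "0 < y" "y < 1" using nonterm by (auto simp: y_def frac_lt_1 frac_gt_0_iff)
  then obtain i where i: "y * of_int b ^ i < 1" "1 \<le> y * of_int b ^ Suc i"
    using ex_power_scaling[of "real_of_int b" y] \<open>b \<ge> 2\<close> by auto
  have x: "x * of_int b ^ (N + i) = \<lfloor>x * of_int b ^ N\<rfloor> * of_int b ^ i + y * of_int b ^ i"
    unfolding y_def frac_def by (simp add: power_add algebra_simps)
  have "0 \<le> y * of_int b ^ i" using \<open>0 < y\<close> \<open>b \<ge> 2\<close> by simp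
  have floor: "\<lfloor>x * of_int b ^ (N + i)\<rfloor> = \<lfloor>x * of_int b ^ N\<rfloor> * b ^ i"
  proof (rule floor_unique)
    show "real_of_int (\<lfloor>x * of_int b ^ N\<rfloor> * b ^ i) \<le> x * of_int b ^ (N + i)" using x \<open>0 \<le> y * of_int b ^ i\<close> by simp
    show "x * of_int b ^ (N + i) < real_of_int (\<lfloor>x * of_int b ^ N\<rfloor> * b ^ i) + 1" using x i(1) by simp
  qed
  have "y * of_int b ^ Suc i \<noteq> 1"
  proof
    assume *: "y * of_int b ^ Suc i = 1"
    have "x * of_int b ^ (N + Suc i) = (x * of_int b ^ (N + i)) * of_int b" by simp
    also have "\<dots> = \<lfloor>x * of_int b ^ N\<rfloor> * of_int b ^ Suc i + y * of_int b ^ Suc i" unfolding x by (simp add: algebra_simps)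
    also have "\<dots> = real_of_int (\<lfloor>x * of_int b ^ N\<rfloor> * b ^ Suc i + 1)" unfolding * by simp
    finally have "x * of_int b ^ (N + Suc i) \<in> \<int>" by (metis Ints_of_int)
    then show False using nonterm by blast
  qed
  then have "1 < y * of_int b ^ Suc i" using i(2) by simp
  then have "1 / b < y * of_int b ^ i" using \<open>b \<ge> 2\<close> by (simp add: field_simps)
  then have "\<lfloor>x * of_int b ^ (N + i)\<rfloor> + 1 / b < x * of_int b ^ (N + i)" unfolding floor unfolding x by simp
  then show thesis by (intro that[of "N + i"]) auto
qed

text \<open>Changing \<open>b ^ L\<close> by a multiple of \<open>Q\<close> changes
  \<open>A\<^sup>2 * b ^ L\<close> by a multiple of \<open>Q * A\<close>. Hence one favourable
  exponent past the preperiod modulo \<open>Q\<close> recurs forever.\<close>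

lemma frequently_residue:
  fixes b A Q M e :: int
  assumes "Q > 0" and smooth: "\<And>y j. y dvd Q \<Longrightarrow> y dvd b ^ j \<Longrightarrow> y dvd b ^ i"
    and i: "Q * A < b * ((A\<^sup>2 * b ^ i + e * M) mod (Q * A))"
  shows "\<exists>\<^sub>\<infinity>L. Q * A < b * ((A\<^sup>2 * b ^ L + e * M) mod (Q * A))"
proof -
  obtain P where P: "P > 0" "\<And>n. Q dvd b ^ (i + n * P) - b ^ i"
    by (rule powers_recur_mod[OF \<open>Q > 0\<close>, of b i]) (use smooth in auto)
  have *: "(A\<^sup>2 * b ^ (i + n * P) + e * M) mod (Q * A) = (A\<^sup>2 * b ^ i + e * M) mod (Q * A)" for n
  proof -
    have "Q * A dvd (b ^ (i + n * P) - b ^ i) * (A * A)"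
      using P(2)[of n] by (intro mult_dvd_mono) auto
    also have "\<dots> = (A\<^sup>2 * b ^ (i + n * P) + e * M) - (A\<^sup>2 * b ^ i + e * M)"
      by (simp add: power2_eq_square algebra_simps)
    finally show ?thesis by (simp add: mod_eq_dvd_iff)
  qed
  show ?thesis
  proof (unfold INFM_nat_le, intro allI exI conjI)
    fix m
    show "m \<le> i + m * P" using P(1) by (metis le_add2 le_trans mult_le_mono2 mult.right_neutral Suc_le_eq One_nat_def)
    show "Q * A < b * ((A\<^sup>2 * b ^ (i + m * P) + e * M) mod (Q * A))" unfolding * by (rule i)
  qed
qed

text \<open>
  The next partial quotient \<open>a\<close> with \<open>L\<close> digits satisfies \<open>q a = A b\<^sup>L + D - r\<close>, where \<open>D\<close> does not
  depend on \<open>L\<close>. As \<open>L\<close> grows, the quotient \<open>A/q\<close> of the new state tends to \<open>R/(q A)\<close>, and the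
  difference is exactly \<open>- e D M/(q A q')\<close> with \<open>q'\<close> the new denominator. So the approach is from below when
  \<open>e D > 0\<close>, which makes up for a terminating expansion of \<open>R/(q A)\<close> and permits \<open>R = q A\<close>.
\<close>

locale extension =
  fixes b A q r M e R D :: int
  assumes b: "b \<ge> 2" and A: "A > 0" and q: "q > 0" and M: "M > 0" and e: "e = 1 \<or> e = - 1"
    and AD: "A * D = A * r + e * M - R"
    and R_gt: "q * A < b * R" and R_le: "R < q * A \<or> R = q * A \<and> 0 < e * D"
    and D: "D \<noteq> 0" "D \<noteq> r"
    and q_less: "q < b * A" and A_le: "A < q \<or> A = q \<and> D < r"
    and nonterminating_or_below: "(\<forall>j. \<not> q * A dvd R * b ^ j) \<or> 0 < e * D"
begin

definition new_den :: "nat \<Rightarrow> int" where "new_den L = A * b ^ L + D"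

text \<open>\<open>T\<close> is the next value of \<open>A\<close>, not the numerator of a
  convergent. Multiplying by \<open>q\<close> avoids a divisibility assumption.\<close>

definition is_new_num :: "nat \<Rightarrow> int \<Rightarrow> bool" where
  "is_new_num L T \<longleftrightarrow> q * T = b ^ L * R - D * (D - r)"

section \<open>Asymptotics of the extended state for large \<open>L\<close>\<close>

lemma R_pos: "R > 0"
proof -
  have "0 < q * A" using q A by simp
  then have "0 < b * R" using R_gt by linarith
  then show ?thesis using b by (simp add: zero_less_mult_iff)
qed

lemma eventually_new_den_gt: "\<forall>\<^sub>F L in sequentially. c < new_den L"
  using eventually_less_power[OF b A, of "c - D"] by eventually_elim (simp add: new_den_def)

lemma eventually_new_num_gt: "\<forall>\<^sub>F L in sequentially. \<forall>T. is_new_num L T \<longrightarrow> c < T"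
  using eventually_less_power[OF b R_pos, of "q * c + D * (D - r)"]
proof eventually_elim
  case (elim L)
  then have "q * c < q * T" if "is_new_num L T" for T
    using that by (simp add: is_new_num_def mult.commute)
  then show ?case using q by simp
qed

lemma eventually_power_less_new_num:
  "\<forall>\<^sub>F L in sequentially. \<forall>T. is_new_num L T \<longrightarrow> b ^ L < 2 * q * T"
  using eventually_less_power[OF b, of "2 * R - 1" "2 * (D * (D - r))"] R_pos
  by (auto elim!: eventually_mono simp: is_new_num_def mult.assoc algebra_simps)

lemma eventually_den_less: "\<forall>\<^sub>F L in sequentially. \<forall>T. is_new_num L T \<longrightarrow> new_den L < b * T"
proof -
  have "\<forall>\<^sub>F L in sequentially. b * (D * (D - r)) + q * D < (b * R - q * A) * b ^ L"
    using R_gt by (intro eventually_less_power[OF b]) simp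
  then show ?thesis
  proof eventually_elim
    case (elim L)
    have "0 < q * (b * T - new_den L)" if "is_new_num L T" for T
    proof -
      have "q * (b * T - new_den L) = b * (q * T) - q * new_den L" by (simp add: algebra_simps)
      also have "\<dots> = (b * R - q * A) * b ^ L - (b * (D * (D - r)) + q * D)"
        unfolding that[unfolded is_new_num_def] new_den_def by (simp add: algebra_simps)
      finally show ?thesis using elim by simp
    qed
    then show ?case using q by (simp add: zero_less_mult_iff)
  qed
qed

text \<open>\<open>q * (new_den L - T)\<close> is linear in \<open>b ^ L\<close> with leading
  coefficient \<open>q * A - R\<close>. If this vanishes, the constant term decides.\<close>

lemma eventually_num_less: "\<forall>\<^sub>F L in sequentially. \<forall>T. is_new_num L T \<longrightarrow> T < new_den L"
proof -
  have *: "q * (new_den L - T) = (q * A - R) * b ^ L + D * (q + D - r)" if "is_new_num L T" for L T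
    using that by (simp add: is_new_num_def new_den_def algebra_simps)
  have "\<forall>\<^sub>F L in sequentially. 0 < (q * A - R) * b ^ L + D * (q + D - r)"
    using R_le
  proof
    assume "R < q * A"
    then show ?thesis using eventually_less_power[OF b, of "q * A - R" "- (D * (q + D - r))"]
      by (auto elim!: eventually_mono)
  next
    assume R: "R = q * A \<and> 0 < e * D"
    \<comment> \<open>With \<open>R = q * A\<close>, \<open>AD\<close> reads
      \<open>A * (q + D - r) = e * M\<close>, so the constant term has the sign of
      \<open>e * D\<close>.\<close>
    then have "A * (D * (q + D - r)) = e * D * M" using AD by algebra
    moreover have "0 < e * D * M" using R M by simp
    ultimately have "0 < D * (q + D - r)" using A by (metis zero_less_mult_pos)
    then show ?thesis using R by simp
  qed
  then show ?thesis
  proof eventually_elim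
    case (elim L)
    then show ?case using * q by (metis zero_less_mult_pos diff_gt_0_iff_gt)
  qed
qed

text \<open>In the extended state \<open>q\<close> is the previous denominator and
  \<open>M * b ^ L\<close> the new \<open>M\<close>. The left side is at most a constant times
  \<open>T\<close>, and \<open>new_den L\<close> exceeds every constant.\<close>

lemma eventually_den_large:
  "\<forall>\<^sub>F L in sequentially. \<forall>T. is_new_num L T \<longrightarrow> b * (T * q + M * b ^ L) \<le> new_den L * T"
  using eventually_power_less_new_num eventually_new_num_gt[of 0]
    eventually_new_den_gt[of "b * q + 2 * b * q * M"]
proof eventually_elim
  case (elim L)
  show ?case
  proof (intro allI impI)
    fix T assume T: "is_new_num L T"
    have "b * (T * q + M * b ^ L) \<le> b * (T * q + M * (2 * q * T))"
      using elim T b M by (intro mult_left_mono add_left_mono) (auto intro: less_imp_le)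
    also have "\<dots> = (b * q + 2 * b * q * M) * T" by (simp add: algebra_simps)
    also have "\<dots> \<le> new_den L * T" using elim T by (intro mult_right_mono) (auto intro: less_imp_le)
    finally show "b * (T * q + M * b ^ L) \<le> new_den L * T" .
  qed
qed

text \<open>\<open>q * T\<close> is a multiple of \<open>b ^ L\<close> plus a constant, nonzero
  because \<open>D\<close> is neither \<open>0\<close> nor \<open>r\<close>. A \<open>T\<close>
  dividing some power of \<open>b\<close> would therefore divide a fixed power, but \<open>T\<close>
  grows with \<open>L\<close>.\<close>

lemma eventually_num_not_smooth:
  "\<forall>\<^sub>F L in sequentially. \<forall>T j. is_new_num L T \<longrightarrow> \<not> T dvd b ^ j"
proof -
  define F where "F = - (D * (D - r))"
  have "F \<noteq> 0" using D by (simp add: F_def)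
  obtain i where i: "\<bar>F\<bar> < 2 ^ i" by (metis real_arch_pow of_int_less_iff of_int_numeral of_int_power one_less_numeral_iff semiring_norm(76))
  show ?thesis using eventually_ge_at_top[of i] eventually_new_num_gt[of "b ^ i"]
  proof eventually_elim
    case (elim L)
    show ?case
    proof (intro allI impI notI)
      fix T j assume T: "is_new_num L T" "T dvd b ^ j"
      have *: "b ^ L * R + F = q * T" using T(1) by (simp add: is_new_num_def F_def)
      have "T > b ^ i" using elim T by blast
      moreover have "0 < b ^ i" using b by simp
      ultimately have "T > 0" by linarith
      have "T dvd b ^ i"
        by (rule smooth_divisor_of_shifted_power[OF b \<open>F \<noteq> 0\<close> i elim(1) _ _ T(2), of R])
          (use * q \<open>T > 0\<close> in auto)
      then show False using \<open>T > b ^ i\<close> \<open>0 < b ^ i\<close> zdvd_imp_le by fastforce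
    qed
  qed
qed

section \<open>The residue condition for the extended state\<close>

text \<open>The fractional part of the left side decides the residue condition, now with sign
  \<open>- e\<close>. The first two terms on the right are \<open>b ^ i\<close> times
  \<open>T / new_den L\<close>; the error \<open>\<eta>\<close> is independent of \<open>i\<close>
  and vanishes as \<open>L\<close> grows.\<close>

lemma approximation:
  assumes "is_new_num L T" "0 < T" "0 < new_den L" "b ^ L < 2 * q * T"
  obtains \<eta> :: real where "0 < \<eta>" "\<eta> < 2 * q * M / new_den L"
    "\<And>i. (T\<^sup>2 * b ^ i + - e * (M * b ^ L)) / (new_den L * T) =
      R / (q * A) * real_of_int b ^ i - (e * D * M) / (q * A * new_den L) * real_of_int b ^ i - e * \<eta>"
proof
  define Q where "Q = new_den L"
  let ?\<eta> = "real_of_int (M * b ^ L) / (Q * T)"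
  show "0 < ?\<eta>" using M b assms by (simp add: Q_def)
  have "real_of_int (M * b ^ L) < M * (2 * q * T)"
    using assms(4) M unfolding of_int_less_iff by (intro mult_strict_left_mono) auto
  then show "?\<eta> < 2 * q * M / new_den L"
    using assms unfolding Q_def [symmetric] by (simp add: field_simps)
  fix i
  have "q * A * T - R * Q = - (e * D * M)"
  proof -
    have "q * A * T - R * Q = A * (q * T) - R * Q" by simp
    also have "\<dots> = - (D * (A * D - A * r + R))"
      unfolding assms(1)[unfolded is_new_num_def] Q_def new_den_def by (simp add: algebra_simps)
    also have "\<dots> = - (e * D * M)" unfolding AD by simp
    finally show ?thesis .
  qed
  then have "real_of_int (q * A * T - R * Q) = real_of_int (- (e * D * M))" by (simp only:)
  then have *: "real_of_int T / Q = R / (q * A) - (e * D * M) / (q * A * Q)"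
    using q A assms unfolding Q_def [symmetric] by (simp add: field_simps)
  have "(T\<^sup>2 * b ^ i + - e * (M * b ^ L)) / (Q * T) = real_of_int T / Q * real_of_int b ^ i - e * ?\<eta>"
    using assms unfolding Q_def [symmetric] by (simp add: field_simps power2_eq_square)
  then show "(T\<^sup>2 * b ^ i + - e * (M * b ^ L)) / (new_den L * T) =
      R / (q * A) * real_of_int b ^ i - (e * D * M) / (q * A * new_den L) * real_of_int b ^ i - e * ?\<eta>"
    unfolding * Q_def [symmetric] by (simp add: algebra_simps)
qed

text \<open>An exponent \<open>i\<close> that works for the limit \<open>R / (q A)\<close> is fixed
  first. Its fractional part lies strictly between \<open>1 / b\<close> and \<open>1\<close>, so it
  tolerates the small perturbation for large \<open>L\<close>.\<close>

lemma eventually_residue_nonterminating: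
  assumes "\<forall>j. \<not> q * A dvd R * b ^ j"
  shows "\<forall>\<^sub>F L in sequentially. \<forall>T. is_new_num L T \<longrightarrow>
    (\<exists>i\<ge>N. new_den L * T < b * ((T\<^sup>2 * b ^ i + - e * (M * b ^ L)) mod (new_den L * T)))"
proof -
  define x where "x = real_of_int R / (q * A)"
  have "x * real_of_int b ^ j \<notin> \<int>" for j
  proof
    assume "x * real_of_int b ^ j \<in> \<int>"
    then obtain k where "x * real_of_int b ^ j = of_int k" by (auto elim: Ints_cases)
    then have "real_of_int (R * b ^ j) = real_of_int (q * A * k)"
      using q A by (simp add: x_def field_simps)
    then have "R * b ^ j = q * A * k" by (simp only: of_int_eq_iff)
    then show False using assms by (metis dvd_triv_left)
  qed
  then obtain i where i: "N \<le> i" "\<lfloor>x * real_of_int b ^ i\<rfloor> + 1 / b < x * real_of_int b ^ i"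
    using ex_frac_gt_if_nonterminating[OF b] by metis
  define n where "n = \<lfloor>x * real_of_int b ^ i\<rfloor>"
  define \<epsilon> where "\<epsilon> = min (x * real_of_int b ^ i - n - 1 / b) (n + 1 - x * real_of_int b ^ i)"
  define C where "C = \<bar>real_of_int (e * D * M)\<bar> / (q * A) * real_of_int b ^ i + 2 * q * M"
  have "\<epsilon> > 0" unfolding \<epsilon>_def n_def using i(2) by simp
  show ?thesis
    using eventually_new_num_gt[of 0] eventually_new_den_gt[of 0] eventually_power_less_new_num
      eventually_new_den_gt[of "\<lceil>C / \<epsilon>\<rceil>"]
  proof eventually_elim
    case (elim L)
    show ?case
    proof (intro allI impI)
      fix T assume T: "is_new_num L T"
      then have "0 < T" "b ^ L < 2 * q * T" using elim by auto
      define Q where "Q = new_den L"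
      have "Q > 0" using elim by (simp add: Q_def)
      obtain \<eta> :: real where \<eta>: "0 < \<eta>" "\<eta> < 2 * q * M / Q"
        "\<And>i. (T\<^sup>2 * b ^ i + - e * (M * b ^ L)) / (Q * T) =
          x * real_of_int b ^ i - (e * D * M) / (q * A * Q) * real_of_int b ^ i - e * \<eta>"
        using approximation[OF T \<open>0 < T\<close> elim(2) \<open>b ^ L < _\<close>] unfolding Q_def x_def by metis
      have "\<bar>real_of_int (e * D * M) / (q * A * Q) * real_of_int b ^ i + e * \<eta>\<bar> \<le>
          \<bar>real_of_int (e * D * M) / (q * A * Q) * real_of_int b ^ i\<bar> + \<bar>e * \<eta>\<bar>"
        by (rule abs_triangle_ineq)
      also have "\<bar>real_of_int (e * D * M) / (q * A * Q) * real_of_int b ^ i\<bar> =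
          \<bar>real_of_int (e * D * M)\<bar> / (q * A) * real_of_int b ^ i / Q"
        using \<open>Q > 0\<close> q A b by (simp add: abs_mult field_simps)
      also have "\<bar>e * \<eta>\<bar> = \<eta>" using e \<eta>(1) by (auto simp: abs_mult)
      also note \<eta>(2)
      finally have "\<bar>real_of_int (e * D * M) / (q * A * Q) * real_of_int b ^ i + e * \<eta>\<bar> < C / Q"
        by (simp add: C_def add_divide_distrib)
      also have "C / \<epsilon> < Q" using elim(4) unfolding Q_def by linarith
      then have "C / Q < \<epsilon>" using \<open>Q > 0\<close> \<open>\<epsilon> > 0\<close> by (simp add: field_simps)
      finally have close: "\<bar>real_of_int (e * D * M) / (q * A * Q) * real_of_int b ^ i + e * \<eta>\<bar> < \<epsilon>" .
      have "Q * T < b * ((T\<^sup>2 * b ^ i + - e * (M * b ^ L)) mod (Q * T))"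
      proof (rule less_mult_mod_if_between)
        show "n + 1 / b < (T\<^sup>2 * b ^ i + - e * (M * b ^ L)) / (Q * T)"
          "(T\<^sup>2 * b ^ i + - e * (M * b ^ L)) / (Q * T) < n + 1"
          unfolding \<eta>(3) using close unfolding \<epsilon>_def by linarith+
      qed (use b \<open>Q > 0\<close> \<open>T > 0\<close> in auto)
      then show "\<exists>i\<ge>N. new_den L * T < b * ((T\<^sup>2 * b ^ i + - e * (M * b ^ L)) mod (new_den L * T))"
        using i(1) unfolding Q_def by blast
    qed
  qed
qed

text \<open>For large \<open>i\<close> the main term is an integer \<open>k\<close>, and the value
  lies below it by \<open>\<delta> * b ^ i\<close>, up to an error \<open>\<eta>\<close>. Here
  \<open>i\<close> depends on \<open>L\<close>: it is chosen so that this gap is between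
  \<open>1 / b ^ 3\<close> and \<open>1 / b ^ 2\<close>, which makes the fractional part exceed
  \<open>1 / b\<close>.\<close>

lemma eventually_residue_terminating:
  assumes "q * A dvd R * b ^ j" "0 < e * D"
  shows "\<forall>\<^sub>F L in sequentially. \<forall>T. is_new_num L T \<longrightarrow>
    (\<exists>i\<ge>N. new_den L * T < b * ((T\<^sup>2 * b ^ i + - e * (M * b ^ L)) mod (new_den L * T)))"
proof -
  define N' where "N' = max N j"
  show ?thesis
    using eventually_new_num_gt[of 0] eventually_new_den_gt[of 0] eventually_power_less_new_num
      eventually_new_den_gt[of "e * D * M * b ^ (N' + 3)"] eventually_new_den_gt[of "2 * q * M * b ^ 3"]
  proof eventually_elim
    case (elim L)
    show ?case
    proof (intro allI impI)
      fix T assume T: "is_new_num L T"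
      then have "0 < T" "b ^ L < 2 * q * T" using elim by auto
      define Q where "Q = new_den L"
      have "Q > 0" using elim by (simp add: Q_def)
      define \<delta> where "\<delta> = real_of_int (e * D * M) / (q * A * Q)"
      obtain \<eta> :: real where \<eta>: "0 < \<eta>" "\<eta> < 2 * q * M / Q"
        "\<And>i. (T\<^sup>2 * b ^ i + - e * (M * b ^ L)) / (Q * T) =
          real_of_int R / (q * A) * real_of_int b ^ i - \<delta> * real_of_int b ^ i - e * \<eta>"
        using approximation[OF T \<open>0 < T\<close> elim(2) \<open>b ^ L < _\<close>] unfolding Q_def \<delta>_def by metis
      have "0 < e * D * M" using assms(2) M by simp
      then have "\<delta> > 0" using q A \<open>Q > 0\<close> unfolding \<delta>_def
        by (intro divide_pos_pos) (auto simp del: of_int_mult)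
      \<comment> \<open>This bound forces the exponent \<open>i\<close> chosen below to be at least
        \<open>N'\<close>.\<close>
      have small: "\<delta> * real_of_int b ^ (N' + 3) < 1"
      proof -
        have "e * D * M * b ^ (N' + 3) < 1 * Q" using elim by (simp add: Q_def)
        also have "1 * Q \<le> (q * A) * Q"
          using \<open>Q > 0\<close> q A by (intro mult_right_mono) (auto simp: int_one_le_iff_zero_less)
        finally have "real_of_int (e * D * M * b ^ (N' + 3)) < real_of_int (q * A * Q)"
          by (simp only: of_int_less_iff)
        then show ?thesis using \<open>Q > 0\<close> q A unfolding \<delta>_def by (simp add: field_simps)
      qed
      have b2: "real_of_int b \<ge> 2" using b by simp
      \<comment> \<open>The factor \<open>b ^ 2\<close> places \<open>\<delta> * b ^ i\<close> in
        the range from \<open>z ^ 3\<close> to \<open>z ^ 2\<close>, where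
        \<open>z = 1 / b\<close>.\<close>
      define y where "y = \<delta> * real_of_int b ^ 2"
      have "real_of_int b ^ 2 \<le> real_of_int b ^ (N' + 3)" using b2 by (intro power_increasing) auto
      then have "y \<le> \<delta> * real_of_int b ^ (N' + 3)" unfolding y_def using \<open>\<delta> > 0\<close> by simp
      then have "y < 1" using small by simp
      moreover have "0 < y" using \<open>\<delta> > 0\<close> b2 by (simp add: y_def)
      ultimately obtain i where i: "y * real_of_int b ^ i < 1" "1 \<le> y * real_of_int b ^ Suc i"
        using ex_power_scaling[OF b2] by metis
      have "N' \<le> i"
      proof (rule ccontr)
        assume "\<not> N' \<le> i"
        then have "real_of_int b ^ (Suc i + 2) \<le> real_of_int b ^ (N' + 3)" using b2 by (intro power_increasing) auto
        then have "\<delta> * real_of_int b ^ (Suc i + 2) \<le> \<delta> * real_of_int b ^ (N' + 3)" using \<open>\<delta> > 0\<close> by simp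
        moreover have "y * real_of_int b ^ Suc i = \<delta> * real_of_int b ^ (Suc i + 2)"
          by (simp add: y_def power2_eq_square algebra_simps)
        ultimately show False using small i by linarith
      qed
      then have "N \<le> i" "j \<le> i" by (auto simp: N'_def)
      have "q * A dvd R * b ^ i"
        using assms(1) le_imp_power_dvd[OF \<open>j \<le> i\<close>, of b] by (meson dvd_trans mult_dvd_mono dvd_refl)
      then obtain k where k: "R * b ^ i = q * A * k" by (rule dvdE)
      then have "real_of_int (R * b ^ i) = real_of_int (q * A * k)" by (simp only:)
      then have kx: "real_of_int R / (q * A) * real_of_int b ^ i = k" using q A by (simp add: field_simps)
      define z where "z = 1 / real_of_int b"
      have z: "0 < z" "z \<le> 1 / 2" using b2 by (auto simp: z_def field_simps)
      have 1: "\<delta> * real_of_int b ^ i < z ^ 2" using i(1) b2 unfolding y_def z_def by (simp add: field_simps)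
      have 2: "z ^ 3 \<le> \<delta> * real_of_int b ^ i"
        using i(2) b2 unfolding y_def z_def by (simp add: field_simps power2_eq_square power3_eq_cube)
      have 3: "\<eta> < z ^ 3"
      proof -
        have "2 * q * M * b ^ 3 < Q" using elim by (simp add: Q_def)
        then have "real_of_int (2 * q * M * b ^ 3) < Q" by (simp only: of_int_less_iff)
        then have "2 * q * M / Q < z ^ 3" using \<open>Q > 0\<close> b2 unfolding z_def by (simp add: field_simps)
        then show ?thesis using \<eta>(2) by simp
      qed
      have "z ^ 2 \<le> 1 / 2 * z" using z by (simp add: power2_eq_square)
      moreover from this have "z ^ 2 * z \<le> 1 / 4 * z" using z by (intro mult_right_mono) auto
      then have "z ^ 3 \<le> 1 / 4 * z" by (simp add: power2_eq_square power3_eq_cube)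
      ultimately have 4: "z + z ^ 2 + z ^ 3 < 1" using z by linarith
      have 5: "\<bar>e * \<eta>\<bar> = \<eta>" using e \<eta>(1) by (auto simp: abs_mult)
      have "Q * T < b * ((T\<^sup>2 * b ^ i + - e * (M * b ^ L)) mod (Q * T))"
      proof (rule less_mult_mod_if_between)
        show "real_of_int (k - 1) + 1 / b < (T\<^sup>2 * b ^ i + - e * (M * b ^ L)) / (Q * T)"
          unfolding \<eta>(3) kx z_def [symmetric] using 1 3 4 5 by simp
        show "(T\<^sup>2 * b ^ i + - e * (M * b ^ L)) / (Q * T) < real_of_int (k - 1 + 1)"
          unfolding \<eta>(3) kx using 2 3 5 by simp
      qed (use b \<open>Q > 0\<close> \<open>T > 0\<close> in auto)
      then show "\<exists>i\<ge>N. new_den L * T < b * ((T\<^sup>2 * b ^ i + - e * (M * b ^ L)) mod (new_den L * T))"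
        using \<open>N \<le> i\<close> unfolding Q_def by blast
    qed
  qed
qed

text \<open>\<open>N\<close> depends on \<open>D\<close> alone, yet for all large \<open>L\<close>
  every divisor of \<open>new_den L\<close> that divides a power of \<open>b\<close> divides
  \<open>b ^ N\<close>. So any \<open>i \<ge> N\<close> is past the preperiod and
  \<open>frequently_residue\<close> applies.\<close>

lemma eventually_frequently_residue:
  "\<forall>\<^sub>F L in sequentially. \<forall>T. is_new_num L T \<longrightarrow>
    (\<exists>\<^sub>\<infinity>i. new_den L * T < b * ((T\<^sup>2 * b ^ i + - e * (M * b ^ L)) mod (new_den L * T)))"
proof -
  obtain N where N: "\<bar>D\<bar> < 2 ^ N" by (metis abs_ge_zero of_nat_less_two_power zero_le_imp_eq_int of_nat_numeral)
  have "\<forall>\<^sub>F L in sequentially. \<forall>T. is_new_num L T \<longrightarrow>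
    (\<exists>i\<ge>N. new_den L * T < b * ((T\<^sup>2 * b ^ i + - e * (M * b ^ L)) mod (new_den L * T)))"
    proof (cases "\<forall>j. \<not> q * A dvd R * b ^ j")
    case True
    then show ?thesis by (rule eventually_residue_nonterminating)
  next
    case False
    then obtain j where "q * A dvd R * b ^ j" by blast
    moreover have "0 < e * D" using nonterminating_or_below False by blast
    ultimately show ?thesis by (rule eventually_residue_terminating)
  qed
  then show ?thesis using eventually_new_den_gt[of 0] eventually_ge_at_top[of N]
  proof eventually_elim
    case (elim L)
    show ?case
    proof (intro allI impI)
      fix T assume "is_new_num L T"
      then obtain i where i: "N \<le> i"
        "new_den L * T < b * ((T\<^sup>2 * b ^ i + - e * (M * b ^ L)) mod (new_den L * T))"
        using elim by blast
      show "\<exists>\<^sub>\<infinity>i. new_den L * T < b * ((T\<^sup>2 * b ^ i + - e * (M * b ^ L)) mod (new_den L * T))"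
      proof (rule frequently_residue[OF elim(2) _ i(2)])
        fix y j assume y: "y dvd new_den L" "y dvd b ^ j"
        have "y dvd b ^ N"
          by (rule smooth_divisor_of_shifted_power[OF b D(1) N elim(3) _ _ y(2), of A])
            (use y(1) elim(2) in \<open>auto simp: new_den_def mult.commute\<close>)
        then show "y dvd b ^ i" using le_imp_power_dvd[OF i(1)] by (rule dvd_trans)
      qed
    qed
  qed
qed

text \<open>The bounds say that \<open>a\<close> has exactly \<open>L\<close> digits. They follow
  from \<open>q < b * A\<close> and \<open>A < q\<close>; if \<open>A = q\<close>, then
  \<open>D < r\<close> gives the upper one.\<close>

lemma eventually_digit_bounds:
  "\<forall>\<^sub>F L in sequentially. \<forall>a. q * a = A * b ^ L + D - r \<longrightarrow> b ^ (L - 1) \<le> a \<and> a < b ^ L"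
proof -
  have "\<forall>\<^sub>F L in sequentially. D - r < (q - A) * b ^ L"
    using A_le eventually_less_power[OF b, of "q - A" "D - r"] by auto
  moreover have "\<forall>\<^sub>F L in sequentially. - (b * (D - r)) < (b * A - q) * b ^ L"
    using q_less by (intro eventually_less_power[OF b]) simp
  ultimately show ?thesis using eventually_gt_at_top[of 0]
  proof eventually_elim
    case (elim L)
    show ?case
    proof (intro allI impI)
      fix a assume a: "q * a = A * b ^ L + D - r"
      have "q * a < q * b ^ L" using elim(1) unfolding a by (simp add: algebra_simps)
      then have "a < b ^ L" using q by simp
      have "q * (b * a) = b * (A * b ^ L + D - r)" unfolding a[symmetric] by (simp add: algebra_simps)
      also have "\<dots> > q * b ^ L" using elim(2) by (simp add: algebra_simps)
      finally have "b ^ L < b * a" using q by simp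
      then have "b * b ^ (L - 1) < b * a" using elim(3) by (simp flip: power_Suc)
      then show "b ^ (L - 1) \<le> a \<and> a < b ^ L" using \<open>a < b ^ L\<close> b by simp
    qed
  qed
qed

lemma eventually_extendable:
  "\<forall>\<^sub>F L in sequentially. \<forall>a T. q * a = A * b ^ L + D - r \<longrightarrow> q * T = b ^ L * R - D * (D - r) \<longrightarrow>
     b ^ (L - 1) \<le> a \<and> a < b ^ L \<and> extendable b T (A * b ^ L + D) q (M * b ^ L) (- e)"
  using eventually_digit_bounds eventually_frequently_residue eventually_num_not_smooth
    eventually_den_large eventually_num_less eventually_den_less eventually_new_den_gt[of 0]
  by eventually_elim (simp add: extendable_def flip: new_den_def is_new_num_def)

end

section \<open>Continued fractions\<close>

abbreviation all_pos :: "nat list \<Rightarrow> bool" where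
  "all_pos w \<equiv> \<forall>a\<in>set w. 0 < a"

text \<open>Numerators and denominators of the last two convergents of \<open>[0; a\<^sub>1, \<dots>, a\<^sub>n]\<close>, in the
  order \<open>p\<^sub>n, q\<^sub>n, p\<^sub>n\<^sub>-\<^sub>1, q\<^sub>n\<^sub>-\<^sub>1\<close>.\<close>

definition convergents :: "nat list \<Rightarrow> nat \<times> nat \<times> nat \<times> nat" where
  "convergents = foldl (\<lambda>(p, q, p', q') a. (a * p + p', a * q + q', p, q)) (0, 1, 1, 0)"

definition num :: "nat list \<Rightarrow> nat" where "num w = fst (convergents w)"
definition den :: "nat list \<Rightarrow> nat" where "den w = fst (snd (convergents w))"
definition prev_num :: "nat list \<Rightarrow> nat" where "prev_num w = fst (snd (snd (convergents w)))"
definition prev_den :: "nat list \<Rightarrow> nat" where "prev_den w = snd (snd (snd (convergents w)))"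

lemmas convergent_defs = num_def den_def prev_num_def prev_den_def convergents_def

lemma convergents_Nil [simp]: "num [] = 0" "den [] = 1" "prev_num [] = 1" "prev_den [] = 0"
  by (simp_all add: convergent_defs)

lemma convergents_snoc [simp]:
  "num (w @ [a]) = a * num w + prev_num w" "den (w @ [a]) = a * den w + prev_den w"
  "prev_num (w @ [a]) = num w" "prev_den (w @ [a]) = den w"
  by (simp_all add: convergent_defs case_prod_beta)

lemma convergents_det:
  "int (prev_num w) * int (den w) - int (num w) * int (prev_den w) = (- 1) ^ length w"
  by (induction w rule: rev_induct) (simp_all add: algebra_simps)

lemma den_pos_and_ge_length: "all_pos w \<Longrightarrow> 0 < den w \<and> length w \<le> den w"
proof -
  \<comment> \<open>Positivity of \<open>prev_den\<close> makes \<open>den\<close> grow at each step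
    after the first; for \<open>[]\<close> it fails.\<close>
  have "0 < den w \<and> length w \<le> den w \<and> (w \<noteq> [] \<longrightarrow> 0 < prev_den w)" if "all_pos w"
    using that
  proof (induction w rule: rev_induct)
    case (snoc a w)
    have "1 * den w \<le> a * den w" using snoc.prems by (intro mult_le_mono1) auto
    then have "den w + prev_den w \<le> den (w @ [a])" by simp
    then show ?case using snoc by (cases "w = []") (auto simp: convergents_snoc(4)[of "[]" a, simplified] simp del: convergents_snoc(1,2))
  qed simp
  then show "all_pos w \<Longrightarrow> ?thesis" by blast
qed

text \<open>This is the finite continued fraction with \<open>z\<close> added to its last term;
  \<open>z\<close> stands for the value of a continuation.\<close>

primrec cfrac_with_tail :: "nat list \<Rightarrow> real \<Rightarrow> real" where
  "cfrac_with_tail [] z = z"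
| "cfrac_with_tail (a # as) z = 1 / (real a + cfrac_with_tail as z)"

lemma cfrac_with_tail_append: "cfrac_with_tail (u @ v) z = cfrac_with_tail u (cfrac_with_tail v z)"
  by (induction u) simp_all

lemma finite_cfrac_eq: "finite_cfrac w = cfrac_with_tail w 0"
  by (induction w) simp_all

lemma cfrac_with_tail_eq:
  fixes z :: real
  assumes "all_pos w" "0 \<le> z"
  shows "cfrac_with_tail w z = (num w + z * prev_num w) / (den w + z * prev_den w)"
  using assms
proof (induction w arbitrary: z rule: rev_induct)
  case (snoc a w)
  then have "0 < a" "0 < den w" using den_pos_and_ge_length by auto
  have "0 \<le> 1 / (a + z)" using snoc.prems by simp
  then have "cfrac_with_tail (w @ [a]) z =
      (num w + 1 / (a + z) * prev_num w) / (den w + 1 / (a + z) * prev_den w)"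
    using snoc by (simp add: cfrac_with_tail_append)
  also have "\<dots> = ((a + z) * num w + prev_num w) / ((a + z) * den w + prev_den w)"
  proof -
    have "0 < a + z" using \<open>0 < a\<close> snoc.prems by simp
    then have "u + 1 / (a + z) * v = ((a + z) * u + v) / (a + z)" for u v
      by (simp add: add_divide_distrib)
    then show ?thesis using \<open>0 < a + z\<close> by simp
  qed
  finally show ?case by (simp add: algebra_simps)
qed simp

lemma finite_cfrac_eq_convergent: "all_pos w \<Longrightarrow> finite_cfrac w = num w / den w"
  using cfrac_with_tail_eq[of w 0] by (simp add: finite_cfrac_eq)

text \<open>By the determinant identity the difference is, up to sign,
  \<open>z / (q (q + z q'))\<close> with the last two denominators \<open>q\<close> and
  \<open>q'\<close>.\<close>

lemma cfrac_with_tail_dist: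
  fixes z :: real
  assumes "all_pos w" "0 \<le> z"
  shows "\<bar>cfrac_with_tail w z - finite_cfrac w\<bar> \<le> z / (den w)\<^sup>2"
proof -
  have q: "0 < den w" using den_pos_and_ge_length assms by blast
  define Q where "Q = den w + z * prev_den w"
  have Q: "den w \<le> Q" "0 < Q" using q assms by (auto simp: Q_def intro: add_pos_nonneg)
  have "real_of_int (int (prev_num w) * int (den w) - int (num w) * int (prev_den w)) = (- 1) ^ length w"
    unfolding convergents_det by simp
  then have det: "real (prev_num w) * den w - num w * prev_den w = (- 1) ^ length w" by simp
  have "cfrac_with_tail w z - finite_cfrac w = z * (real (prev_num w) * den w - num w * prev_den w) / (den w * Q)"
    unfolding cfrac_with_tail_eq[OF assms] finite_cfrac_eq_convergent[OF assms(1)] Q_def [symmetric]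
    using q Q by (simp add: divide_simps) (simp add: Q_def algebra_simps)
  also have "\<bar>\<dots>\<bar> = z / (den w * Q)" using q Q assms(2) unfolding det by (simp add: abs_mult power_abs)
  also have "\<dots> \<le> z / (den w * den w)"
    using q Q assms(2) by (intro divide_left_mono mult_left_mono mult_pos_pos) auto
  finally show ?thesis by (simp add: power2_eq_square)
qed

lemma cfrac_with_tail_dist_le_tail:
  assumes "all_pos w" "0 \<le> z"
  shows "\<bar>cfrac_with_tail w z - finite_cfrac w\<bar> \<le> z"
proof -
  have "z / (den w)\<^sup>2 \<le> z / 1"
    using den_pos_and_ge_length[OF assms(1)] assms(2) by (intro divide_left_mono) auto
  then show ?thesis using cfrac_with_tail_dist[OF assms] by simp
qed

lemma cfrac_with_tail_dist_le_length:
  assumes "all_pos w" "w \<noteq> []" "0 \<le> z" "z \<le> 1"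
  shows "\<bar>cfrac_with_tail w z - finite_cfrac w\<bar> \<le> 1 / length w"
proof -
  have q: "0 < den w" "length w \<le> den w" using den_pos_and_ge_length assms by blast+
  have "den w * 1 \<le> den w * den w" using q by (intro mult_le_mono2) auto
  then have "length w \<le> (den w)\<^sup>2" using q by (simp only: power2_eq_square)
  then have "real (length w) \<le> (real (den w))\<^sup>2" by (simp only: flip: of_nat_power of_nat_le_iff)
  then have "z / (den w)\<^sup>2 \<le> 1 / length w" using assms by (intro frac_le) auto
  then show ?thesis using cfrac_with_tail_dist[of w z] assms by simp
qed

lemma finite_cfrac_nonneg: "0 \<le> finite_cfrac w"
  by (induction w) auto

lemma finite_cfrac_le_1: "all_pos w \<Longrightarrow> finite_cfrac w \<le> 1"
proof (cases w)
  case (Cons a v)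
  moreover assume "all_pos w"
  ultimately have "1 \<le> real a + finite_cfrac v" using finite_cfrac_nonneg[of v] by auto
  then show ?thesis using Cons by simp
qed simp

text \<open>For positive terms, these are the numbers with first partial quotients \<open>w\<close>
  and a remainder in \<open>(0,1)\<close>. Omitting the endpoints makes the set open.\<close>

primrec cylinder :: "nat list \<Rightarrow> real set" where
  "cylinder [] = {0<..<1}"
| "cylinder (a # as) = {x. 0 < x \<and> 1 / x - real a \<in> cylinder as}"

lemma open_cylinder: "open (cylinder w)"
proof (induction w)
  case (Cons a w)
  have "open ({0<..} \<inter> (\<lambda>x. 1 / x - real a) -` cylinder w)"
    by (rule continuous_open_preimage[OF _ _ Cons]) (auto intro!: continuous_intros)
  also have "{0<..} \<inter> (\<lambda>x. 1 / x - real a) -` cylinder w = cylinder (a # w)" by auto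
  finally show ?case .
qed simp

lemma cylinder_subset_unit_interval: "all_pos w \<Longrightarrow> cylinder w \<subseteq> {0<..<1}"
proof (induction w)
  case (Cons a w)
  show ?case
  proof
    fix x assume "x \<in> cylinder (a # w)"
    then have "0 < x" "0 < 1 / x - real a" using Cons by auto
    moreover have "1 \<le> real a" using Cons.prems by auto
    ultimately have "1 < 1 / x" by linarith
    then show "x \<in> {0<..<1}" using \<open>0 < x\<close> by (simp add: field_simps)
  qed
qed simp

lemma cylinder_append: "x \<in> cylinder (u @ v) \<Longrightarrow> all_pos v \<Longrightarrow> x \<in> cylinder u"
  by (induction u arbitrary: x) (use cylinder_subset_unit_interval[of v] in auto)

lemma cylinder_unique:
  "x \<in> cylinder u \<Longrightarrow> x \<in> cylinder v \<Longrightarrow> all_pos u \<Longrightarrow> all_pos v \<Longrightarrow> length u = length v \<Longrightarrow> u = v"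
proof (induction u arbitrary: x v)
  case (Cons a u)
  then obtain c v' where v: "v = c # v'" by (cases v) auto
  have 1: "1 / x - real a \<in> cylinder u" "1 / x - real c \<in> cylinder v'" using Cons v by auto
  then have "1 / x - real a \<in> {0<..<1}" "1 / x - real c \<in> {0<..<1}"
    using cylinder_subset_unit_interval[of u] cylinder_subset_unit_interval[of v'] Cons.prems v by auto
  then have "a = c" by simp
  then show ?case using Cons.IH[of _ v'] 1 Cons.prems v by auto
qed simp

lemma cylinder_imp_cfrac_with_tail:
  "x \<in> cylinder w \<Longrightarrow> \<exists>z. 0 < z \<and> z < 1 \<and> x = cfrac_with_tail w z"
proof (induction w arbitrary: x)
  case (Cons a w)
  then obtain z where z: "0 < z" "z < 1" "1 / x - real a = cfrac_with_tail w z" by auto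
  then have "x = cfrac_with_tail (a # w) z" using Cons.prems by (simp flip: z(3))
  then show ?case using z by blast
qed simp

lemma cylinder_dist_le_length:
  assumes "x \<in> cylinder w" "all_pos w" "w \<noteq> []"
  shows "\<bar>x - finite_cfrac w\<bar> \<le> 1 / length w"
  using cylinder_imp_cfrac_with_tail[OF assms(1)] cfrac_with_tail_dist_le_length[of w] assms by auto

text \<open>Euclid's algorithm: each step turns \<open>u / v\<close> into a fraction with the
  smaller denominator \<open>u\<close>.\<close>

lemma fraction_not_in_long_cylinder:
  "real u / real v \<in> cylinder w \<Longrightarrow> all_pos w \<Longrightarrow> 0 < v \<Longrightarrow> length w < v"
proof (induction w arbitrary: u v)
  case (Cons a w)
  define x where "x = real u / real v"
  have x: "0 < x" "x < 1" "1 / x - real a \<in> cylinder w"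
    using Cons.prems cylinder_subset_unit_interval[of "a # w"] unfolding x_def by auto
  then have "0 < u" "u < v" using Cons.prems(3) by (auto simp: x_def zero_less_divide_iff)
  have eq: "1 / x - real a = (real v - real a * real u) / real u"
    using \<open>0 < u\<close> by (simp add: x_def field_simps)
  have "0 < 1 / x - real a" using x(3) cylinder_subset_unit_interval[of w] Cons.prems by auto
  then have "real (a * u) < real v" using \<open>0 < u\<close> unfolding eq by (simp add: zero_less_divide_iff)
  then have "real v - real a * real u = real (v - a * u)" by (simp add: of_nat_diff flip: of_nat_mult)
  then have "length w < u" using x(3) Cons \<open>0 < u\<close> unfolding eq by auto
  then show ?case using \<open>u < v\<close> by simp
qed simp

section \<open>Infinite continued fractions\<close>

lemma positive_stake: "\<forall>i. 0 < a !! i \<Longrightarrow> all_pos (stake n a)"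
  by (auto simp: set_conv_nth stake_nth)

text \<open>One step of the Gauss map, carried through the limit. Truncations of the tail lie in
  \<open>[0,1]\<close>, so nonempty ones of \<open>x\<close> are at least
  \<open>1 / (shd a + 1)\<close>, which keeps the limit away from \<open>0\<close>.\<close>

lemma has_infinite_cfrac_tail:
  assumes "has_infinite_cfrac x a"
  shows "0 < x" "has_infinite_cfrac (1 / x - real (shd a)) (stl a)"
proof -
  have pos: "\<And>i. a !! i > 0" and lim: "(\<lambda>n. finite_cfrac (stake n a)) \<longlonglongrightarrow> x"
    using assms by (auto simp: has_infinite_cfrac_def)
  have "0 < shd a" using pos[of 0] by simp
  define Y where "Y n = finite_cfrac (stake n (stl a))" for n
  have pos': "0 < stl a !! i" for i using pos[of "Suc i"] by simp
  have "all_pos (stake n (stl a))" for n using pos' by (intro positive_stake) blast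
  then have Y: "0 \<le> Y n" "Y n \<le> 1" for n
    unfolding Y_def using finite_cfrac_nonneg finite_cfrac_le_1 by blast+
  have limY: "(\<lambda>n. 1 / (shd a + Y n)) \<longlonglongrightarrow> x"
    using LIMSEQ_Suc[OF lim] by (simp add: Y_def)
  have "1 / (real (shd a) + 1) \<le> 1 / (shd a + Y n)" for n
    using Y[of n] \<open>0 < shd a\<close> by (intro frac_le) simp_all
  then have "1 / (real (shd a) + 1) \<le> x" by (intro LIMSEQ_le_const[OF limY]) blast
  moreover have "0 < 1 / (real (shd a) + 1)" by simp
  ultimately show "0 < x" by linarith
  then have "(\<lambda>n. 1 / (1 / (shd a + Y n)) - shd a) \<longlonglongrightarrow> 1 / x - shd a"
    by (intro tendsto_diff tendsto_divide tendsto_const limY) simp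
  then have "Y \<longlonglongrightarrow> 1 / x - shd a" by simp
  then show "has_infinite_cfrac (1 / x - real (shd a)) (stl a)"
    using pos' by (simp add: has_infinite_cfrac_def Y_def [abs_def])
qed

lemma has_infinite_cfrac_less_1:
  assumes "has_infinite_cfrac x a" shows "x < 1"
proof -
  have "0 < x" "0 < 1 / x - real (shd a)" using has_infinite_cfrac_tail assms by blast+
  moreover have "1 \<le> real (shd a)"
    using assms[unfolded has_infinite_cfrac_def, THEN conjunct1, rule_format, of 0] by simp
  ultimately have "1 < 1 / x" by linarith
  then show ?thesis using \<open>0 < x\<close> by (simp add: field_simps)
qed

text \<open>Convergence becomes countably many open conditions. Forward, the Gauss step is iterated;
  backward, a point of a cylinder of length \<open>n\<close> is within \<open>1 / n\<close> of the
  truncation.\<close>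

lemma has_infinite_cfrac_iff:
  "has_infinite_cfrac x a \<longleftrightarrow> (\<forall>i. 0 < a !! i) \<and> (\<forall>n. x \<in> cylinder (stake n a))"
proof
  have "x \<in> cylinder (stake n a)" if "has_infinite_cfrac x a" for n
    using that
  proof (induction n arbitrary: x a)
    case 0
    then show ?case using has_infinite_cfrac_tail has_infinite_cfrac_less_1 by simp
  next
    case (Suc n)
    then show ?case using has_infinite_cfrac_tail by simp
  qed
  then show "has_infinite_cfrac x a \<Longrightarrow> (\<forall>i. 0 < a !! i) \<and> (\<forall>n. x \<in> cylinder (stake n a))"
    by (auto simp: has_infinite_cfrac_def)
next
  assume *: "(\<forall>i. 0 < a !! i) \<and> (\<forall>n. x \<in> cylinder (stake n a))"
  have "(\<lambda>n. finite_cfrac (stake n a)) \<longlonglongrightarrow> x"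
  proof (rule metric_tendsto_imp_tendsto[OF lim_1_over_n eventually_sequentiallyI])
    fix n :: nat assume "1 \<le> n"
    have "\<bar>x - finite_cfrac (stake n a)\<bar> \<le> 1 / length (stake n a)"
      by (rule cylinder_dist_le_length) (use * positive_stake[of a n] \<open>1 \<le> n\<close> in auto)
    then show "dist (finite_cfrac (stake n a)) x \<le> dist (1 / real n) 0"
      by (simp add: dist_real_def abs_minus_commute)
  qed
  with * show "has_infinite_cfrac x a" by (simp add: has_infinite_cfrac_def)
qed

lemma has_infinite_cfrac_irrational:
  assumes "has_infinite_cfrac x a" shows "x \<notin> \<rat>"
proof
  assume "x \<in> \<rat>"
  then obtain u v :: nat where uv: "0 < v" "\<bar>x\<bar> = real u / real v" by (metis Rats_abs_nat_div_natE neq0_conv)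
  have "0 < x" by (rule has_infinite_cfrac_tail(1)[OF assms])
  then have "real u / real v \<in> cylinder (stake v a)" using assms uv by (simp add: has_infinite_cfrac_iff)
  then have "length (stake v a) < v"
    using uv assms by (intro fraction_not_in_long_cylinder[of u] positive_stake) (auto simp: has_infinite_cfrac_iff)
  then show False by simp
qed

text \<open>A longer truncation is a shorter one with a tail in \<open>[0,1]\<close>, so the
  truncations form a Cauchy sequence.\<close>

lemma infinite_cfrac_converges:
  assumes "\<forall>i. 0 < a !! i"
  obtains x where "has_infinite_cfrac x a"
proof -
  define X where "X n = finite_cfrac (stake n a)" for n
  have close: "\<bar>X (n + k) - X n\<bar> \<le> 1 / n" if "n \<ge> 1" for n k
  proof -
    let ?v = "stake k (sdrop n a)"
    have v: "all_pos ?v" using assms by (intro positive_stake) (simp add: sdrop_snth)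
    have "X (n + k) = finite_cfrac (stake n a @ ?v)" by (simp add: X_def)
    also have "\<dots> = cfrac_with_tail (stake n a) (finite_cfrac ?v)"
      unfolding finite_cfrac_eq cfrac_with_tail_append ..
    finally have "X (n + k) = cfrac_with_tail (stake n a) (finite_cfrac ?v)" .
    then show ?thesis
      using cfrac_with_tail_dist_le_length[of "stake n a" "finite_cfrac ?v"] that
        positive_stake[OF assms, of n] finite_cfrac_nonneg finite_cfrac_le_1[OF v] by (simp add: X_def)
  qed
  have "Cauchy X"
  proof (rule CauchyI')
    fix \<epsilon> :: real assume "0 < \<epsilon>"
    obtain N where N: "1 / \<epsilon> < real N" using reals_Archimedean2[of "1 / \<epsilon>"] by auto
    moreover have "0 < 1 / \<epsilon>" using \<open>0 < \<epsilon>\<close> by simp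
    ultimately have "0 < real N" by linarith
    show "\<exists>M. \<forall>m\<ge>M. \<forall>n>m. dist (X m) (X n) < \<epsilon>"
    proof (intro exI allI impI)
      fix m n assume mn: "N \<le> m" "m < n"
      then have "0 < m" using \<open>0 < real N\<close> by linarith
      have 1: "\<bar>X (m + (n - m)) - X m\<bar> \<le> 1 / m" by (rule close) (use \<open>0 < m\<close> in linarith)
      have "real N \<le> real m" using mn(1) by (rule of_nat_mono)
      then have 2: "1 / real m \<le> 1 / real N" using frac_le[of 1 1 "real N" "real m"] \<open>0 < real N\<close> by simp
      have 3: "1 / N < \<epsilon>" using N \<open>0 < \<epsilon>\<close> \<open>0 < real N\<close> by (simp add: field_simps)
      have "m + (n - m) = n" using mn by simp
      then have "\<bar>X n - X m\<bar> < \<epsilon>" using 1 2 3 by simp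
      then show "dist (X m) (X n) < \<epsilon>" by (simp add: dist_real_def abs_minus_commute)
    qed
  qed
  then obtain x where "X \<longlonglongrightarrow> x" by (metis Cauchy_convergent convergent_def)
  then show thesis using assms by (intro that[of x]) (simp add: has_infinite_cfrac_def X_def [abs_def])
qed

section \<open>Digit strings and the \<open>G\<^sub>\<delta>\<close> property\<close>

definition digit_string :: "nat \<Rightarrow> nat list \<Rightarrow> nat list" where
  "digit_string b w = concat (map (base_digits b) w)"

definition digit_value :: "nat \<Rightarrow> nat list \<Rightarrow> nat" where
  "digit_value b ds = foldl (\<lambda>v d. v * b + d) 0 ds"

lemma digit_value_Nil [simp]: "digit_value b [] = 0"
  by (simp add: digit_value_def)

lemma digit_value_snoc [simp]: "digit_value b (ds @ [d]) = digit_value b ds * b + d"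
  by (simp add: digit_value_def)

lemma digit_value_append: "digit_value b (ds @ es) = digit_value b ds * b ^ length es + digit_value b es"
proof (induction es rule: rev_induct)
  case (snoc e es)
  have "digit_value b (ds @ es @ [e]) = digit_value b (ds @ es) * b + e"
    using digit_value_snoc[of b "ds @ es" e] by simp
  then show ?case using snoc by (simp add: algebra_simps)
qed simp

lemma digit_value_base_digits: "2 \<le> b \<Longrightarrow> digit_value b (base_digits b n) = n"
  unfolding digit_value_def by (rule base_digits_value)

lemma digit_string_snoc [simp]: "digit_string b (w @ [a]) = digit_string b w @ base_digits b a"
  by (simp add: digit_string_def)

lemma length_base_digits:
  assumes "2 \<le> b" "b ^ L \<le> n" "n < b ^ Suc L"
  shows "length (base_digits b n) = Suc L"
  using assms(2,3)
proof (induction L arbitrary: n)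
  case 0
  then show ?case using assms(1) by (simp add: base_digits.simps[of b n] base_digits.simps[of b 0])
next
  case (Suc L)
  have "b ^ L \<le> n div b" using Suc.prems(1) assms(1) by (simp add: less_eq_div_iff_mult_less_eq mult.commute)
  moreover have "n div b < b ^ Suc L" using Suc.prems(2) assms(1) by (simp add: less_mult_imp_div_less mult.commute)
  ultimately have "length (base_digits b (n div b)) = Suc L" by (rule Suc.IH)
  moreover have "0 < b ^ Suc L" using assms(1) by simp
  then have "n \<noteq> 0" using Suc.prems(1) by linarith
  ultimately show ?case using assms(1) by (simp add: base_digits.simps[of b n])
qed

lemma length_le_length_digit_string: "2 \<le> b \<Longrightarrow> all_pos w \<Longrightarrow> length w \<le> length (digit_string b w)"
proof (induction w rule: rev_induct)
  case (snoc a w)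
  then show ?case using base_digits_nonempty[of b a] by (cases "base_digits b a") auto
qed simp

lemma stake_flat_digits:
  assumes "2 \<le> b" "\<forall>i. 0 < a !! i"
  shows "stake (length (digit_string b (stake n a))) (flat (smap (base_digits b) a)) = digit_string b (stake n a)"
proof -
  have "flat (smap (base_digits b) a) = digit_string b (stake n a) @- flat (smap (base_digits b) (sdrop n a))"
    using assms(2)
  proof (induction n arbitrary: a)
    case (Suc n)
    have "0 < shd a" using Suc.prems[rule_format, of 0] by simp
    then have "flat (smap (base_digits b) a) = base_digits b (shd a) @- flat (smap (base_digits b) (stl a))"
      using base_digits_nonempty[OF assms(1)] by (subst flat_unfold) auto
    moreover have "\<forall>i. 0 < stl a !! i" using Suc.prems by (metis snth.simps(2))
    ultimately show ?case using Suc.IH[of "stl a"] by (simp add: digit_string_def)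
  qed (simp add: digit_string_def)
  then show ?thesis by (simp add: stake_shift)
qed

lemma flat_digits_less:
  assumes "2 \<le> b" "\<forall>i. 0 < a !! i"
  shows "flat (smap (base_digits b) a) !! i < b"
proof -
  have "\<forall>xs\<in>sset (smap (base_digits b) a). xs \<noteq> []"
    using assms base_digits_nonempty by (auto simp: sset_range)
  then have "sset (flat (smap (base_digits b) a)) = (\<Union>xs\<in>sset (smap (base_digits b) a). set xs)"
    by (rule sset_flat)
  moreover have "flat (smap (base_digits b) a) !! i \<in> sset (flat (smap (base_digits b) a))"
    by (rule snth_sset)
  ultimately obtain xs where "xs \<in> sset (smap (base_digits b) a)"
    "flat (smap (base_digits b) a) !! i \<in> set xs" by (simp only: UN_iff) blast
  then show ?thesis using base_digits_less by (auto simp: sset_range)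
qed

lemma base_expansion_partial_sum:
  assumes "0 < b"
  shows "(\<Sum>i<k. real (d !! i) / real b ^ Suc i) = digit_value b (stake k d) / real b ^ k"
proof (induction k)
  case (Suc k)
  have "digit_value b (stake (Suc k) d) = digit_value b (stake k d) * b + d !! k"
    by (simp only: stake_Suc digit_value_snoc)
  then show ?case using Suc assms by (simp add: add_divide_distrib del: stake.simps)
qed simp

text \<open>Partial sums increase, partial sums plus \<open>1 / b ^ k\<close> decrease, and the gap
  tends to \<open>0\<close>. Hence testing a cofinal set of positions suffices; later
  \<open>K\<close> holds the ends of the digit blocks.\<close>

lemma has_base_expansion_iff:
  fixes x :: real
  assumes "2 \<le> b" and less: "\<forall>i. d !! i < b" and cofinal: "\<forall>N. \<exists>k\<in>K. N \<le> k"
  shows "has_base_expansion b x d \<longleftrightarrow>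
    (\<forall>k\<in>K. real (digit_value b (stake k d)) \<le> x * real b ^ k \<and>
      x * real b ^ k \<le> real (digit_value b (stake k d)) + 1)"
proof -
  define S where "S k = (\<Sum>i<k. real (d !! i) / real b ^ Suc i)" for k
  have b: "0 < real b" using assms(1) by simp
  have K: "real (digit_value b (stake k d)) \<le> x * real b ^ k \<and>
      x * real b ^ k \<le> real (digit_value b (stake k d)) + 1 \<longleftrightarrow>
      S k \<le> x \<and> x \<le> S k + 1 / real b ^ k" for k
  proof -
    have "S k = digit_value b (stake k d) / real b ^ k"
      unfolding S_def using assms(1) by (intro base_expansion_partial_sum) simp
    then have "real (digit_value b (stake k d)) = S k * real b ^ k" using b by simp
    moreover have "S k * real b ^ k + 1 = (S k + 1 / real b ^ k) * real b ^ k"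
      using b by (simp add: distrib_right)
    ultimately show ?thesis using b by (simp del: distrib_right)
  qed
  have "incseq S"
    by (rule incseq_SucI) (use b in \<open>simp add: S_def\<close>)
  have "decseq (\<lambda>k. S k + 1 / real b ^ k)"
  proof (rule decseq_SucI)
    fix k
    have "real (d !! k) + 1 \<le> b" using less[rule_format, of k] by linarith
    then have "(real (d !! k) + 1) / real b ^ Suc k \<le> b / real b ^ Suc k"
      using b by (intro divide_right_mono) auto
    then show "S (Suc k) + 1 / real b ^ Suc k \<le> S k + 1 / real b ^ k"
      using b by (simp add: S_def add_divide_distrib)
  qed
  have lim0: "(\<lambda>k. 1 / real b ^ k) \<longlonglongrightarrow> 0"
    using LIMSEQ_divide_realpow_zero[of "real b" 1] assms(1) by simp
  have "has_base_expansion b x d \<longleftrightarrow> S \<longlonglongrightarrow> x"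
    using less by (simp add: has_base_expansion_def sums_def S_def [abs_def])
  also have "\<dots> \<longleftrightarrow> (\<forall>k\<in>K. S k \<le> x \<and> x \<le> S k + 1 / real b ^ k)"
  proof
    assume lim: "S \<longlonglongrightarrow> x"
    have "(\<lambda>k. S k + 1 / real b ^ k) \<longlonglongrightarrow> x" using tendsto_add[OF lim lim0] by simp
    then show "\<forall>k\<in>K. S k \<le> x \<and> x \<le> S k + 1 / real b ^ k"
      using incseq_le[OF \<open>incseq S\<close> lim] decseq_ge[OF \<open>decseq _\<close>] by blast
  next
    assume *: "\<forall>k\<in>K. S k \<le> x \<and> x \<le> S k + 1 / real b ^ k"
    have bounds: "S k \<le> x" "x \<le> S k + 1 / real b ^ k" for k
    proof -
      obtain k' where k': "k' \<in> K" "k \<le> k'" using cofinal by blast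
      show "S k \<le> x" using incseqD[OF \<open>incseq S\<close> k'(2)] * k'(1) by force
      show "x \<le> S k + 1 / real b ^ k" using decseqD[OF \<open>decseq _\<close> k'(2)] * k'(1) by force
    qed
    have "(\<lambda>k. x - 1 / real b ^ k) \<longlonglongrightarrow> x" using tendsto_diff[OF tendsto_const lim0, of x] by simp
    then show "S \<longlonglongrightarrow> x"
      by (rule tendsto_sandwich[rotated 2]) (use bounds in \<open>auto intro!: eventuallyI simp: algebra_simps\<close>)
  qed
  finally show ?thesis using K by simp
qed

text \<open>Open intervals serve the \<open>G\<^sub>\<delta>\<close> property; the closed variant
  below is preserved under limits.\<close>

definition digit_interval :: "nat \<Rightarrow> nat list \<Rightarrow> real set" where
  "digit_interval b w =
     {x. digit_value b (digit_string b w) < x * real b ^ length (digit_string b w) \<and>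
         x * real b ^ length (digit_string b w) < real (digit_value b (digit_string b w)) + 1}"

definition closed_digit_interval :: "nat \<Rightarrow> nat list \<Rightarrow> real set" where
  "closed_digit_interval b w =
     {x. digit_value b (digit_string b w) \<le> x * real b ^ length (digit_string b w) \<and>
         x * real b ^ length (digit_string b w) \<le> real (digit_value b (digit_string b w)) + 1}"

lemma open_digit_interval: "open (digit_interval b w)"
  unfolding digit_interval_def
  by (intro open_Collect_conj open_Collect_less continuous_intros)

lemma trott_numbers_iff:
  assumes "2 \<le> b"
  shows "x \<in> trott_numbers b \<longleftrightarrow>
    (\<exists>a. has_infinite_cfrac x a \<and>(\<forall>n. x \<in> closed_digit_interval b (stake n a)))"
proof -
  have *: "has_base_expansion b x (flat (smap (base_digits b) a)) \<longleftrightarrow>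
      (\<forall>n. x \<in> closed_digit_interval b (stake n a))"
    if a: "has_infinite_cfrac x a" for a
  proof -
    define K where "K = range (\<lambda>n. length (digit_string b (stake n a)))"
    have pos: "\<forall>i. 0 < a !! i" using a by (simp add: has_infinite_cfrac_def)
    have "\<forall>N. \<exists>k\<in>K. N \<le> k"
      using length_le_length_digit_string[OF assms positive_stake[OF pos]] by (auto simp: K_def)
    then show ?thesis
      using has_base_expansion_iff[OF assms, of "flat (smap (base_digits b) a)" K x]
        flat_digits_less[OF assms pos]
      by (simp add: K_def stake_flat_digits[OF assms pos] closed_digit_interval_def)
  qed
  show ?thesis
    unfolding trott_numbers_def using * has_infinite_cfrac_tail(1) has_infinite_cfrac_less_1 by blast
qed

text \<open>The endpoints of digit intervals are rational, whereas infinite continued fractions are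
  irrational.\<close>

lemma trott_numbers_iff_open:
  assumes "2 \<le> b"
  shows "x \<in> trott_numbers b \<longleftrightarrow>
    (\<exists>a. has_infinite_cfrac x a \<and> (\<forall>n. x \<in> digit_interval b (stake n a)))"
proof -
  have *: "x * real b ^ k \<noteq> real m" if a: "has_infinite_cfrac x a" for a k m
  proof
    assume "x * real b ^ k = real m"
    then have "x = real m / real b ^ k" using assms by (simp add: field_simps)
    then have "x \<in> \<rat>" by simp
    then show False using has_infinite_cfrac_irrational[OF a] by blast
  qed
  have "x \<in> closed_digit_interval b (stake n a) \<longleftrightarrow> x \<in> digit_interval b (stake n a)"
    if a: "has_infinite_cfrac x a" for a n
  proof -
    define D k where "D = digit_value b (digit_string b (stake n a))"
      and "k = length (digit_string b (stake n a))"
    have "x * real b ^ k \<noteq> real D" "x * real b ^ k \<noteq> real D + 1"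
      using *[OF a, of k D] *[OF a, of k "D + 1"] by simp_all
    then show ?thesis
      unfolding digit_interval_def closed_digit_interval_def D_def [symmetric] k_def [symmetric] by auto
  qed
  then show ?thesis unfolding trott_numbers_iff[OF assms] by blast
qed

text \<open>A point of the intersection could use unrelated prefixes at different levels; uniqueness
  of cylinders makes them initial segments of one stream.\<close>

theorem gdelta_trott_numbers:
  assumes "2 \<le> b"
  shows "gdelta (trott_numbers b)"
proof -
  define U where "U n = (\<Union>w\<in>{w. all_pos w \<and> length w = n}. cylinder w \<inter> digit_interval b w)" for n
  have "open (U n)" for n
    unfolding U_def by (intro open_UN ballI open_Int open_cylinder open_digit_interval)
  moreover have "trott_numbers b = (\<Inter>n. U n)"
  proof (intro set_eqI iffI)
    fix x assume "x \<in> trott_numbers b"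
    then obtain a where a: "has_infinite_cfrac x a" "\<forall>n. x \<in> digit_interval b (stake n a)"
      using trott_numbers_iff_open[OF assms] by blast
    have "all_pos (stake n a)" for n
      using a(1) by (intro positive_stake) (simp add: has_infinite_cfrac_def)
    moreover have "x \<in> cylinder (stake n a)" for n using a(1) by (simp add: has_infinite_cfrac_iff)
    ultimately have "x \<in> U n" for n
      unfolding U_def using a(2) by (intro UN_I[of "stake n a"]) simp_all
    then show "x \<in> (\<Inter>n. U n)" by blast
  next
    fix x assume "x \<in> (\<Inter>n. U n)"
    then have "\<exists>w. all_pos w \<and> length w = n \<and> x \<in> cylinder w \<and> x \<in> digit_interval b w" for n
      by (auto simp: U_def)
    then obtain W where W: "\<And>n. all_pos (W n)" "\<And>n. length (W n) = n"
      "\<And>n. x \<in> cylinder (W n)" "\<And>n. x \<in> digit_interval b (W n)" by metis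
    define a where "a = smap (\<lambda>n. last (W (Suc n))) nats"
    have stake: "stake n a = W n" for n
    proof (induction n)
      case 0
      then show ?case using W(2)[of 0] by simp
    next
      case (Suc n)
      obtain v l where split: "W (Suc n) = v @ [l]"
        using W(2)[of "Suc n"] by (cases "W (Suc n)" rule: rev_cases) auto
      have "all_pos v" "0 < l" "length v = n" "x \<in> cylinder (v @ [l])"
        using W(1-3)[of "Suc n"] unfolding split by simp_all
      moreover from this have "x \<in> cylinder v" by (intro cylinder_append[of x v "[l]"]) simp_all
      ultimately have "v = W n" using W(1-3)[of n] by (intro cylinder_unique[of x v]) simp_all
      moreover have "a !! n = l" by (simp add: a_def split)
      ultimately show ?case unfolding stake_Suc Suc split by simp
    qed
    have "0 < a !! i" for i
      using W(1)[of "Suc i"] unfolding stake [symmetric] stake_Suc by simp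
    then have "has_infinite_cfrac x a" using W(3) by (simp add: has_infinite_cfrac_iff stake)
    then show "x \<in> trott_numbers b"
      unfolding trott_numbers_iff_open[OF assms] using W(4) by (intro exI[of _ a]) (simp add: stake)
  qed
  ultimately show ?thesis using gdelta.intros[of U] by simp
qed

section \<open>Good prefixes\<close>

definition excess :: "nat \<Rightarrow> nat list \<Rightarrow> int" where
  "excess b w = int b ^ length (digit_string b w) * num w - digit_value b (digit_string b w) * den w"

definition good :: "nat \<Rightarrow> nat list \<Rightarrow> bool" where
  "good b w \<longleftrightarrow> all_pos w \<and>
     extendable b (excess b w) (den w) (prev_den w) (int b ^ length (digit_string b w)) ((- 1) ^ length w)"

text \<open>By pigeonhole one residue \<open>R\<close> occurs for infinitely many \<open>L\<close>.
  Modulo \<open>A\<close> it equals \<open>e * b ^ m\<close>, so \<open>D\<close> is an integer, and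
  for these \<open>L\<close> the next partial quotient is one as well.\<close>

lemma extendable_imp_extension:
  fixes b A q r e :: int
  assumes ext: "extendable b A q r (b ^ m) e" and "b \<ge> 2" "0 \<le> r" and e: "e = 1 \<or> e = - 1"
  shows "\<exists>R D. extension b A q r (b ^ m) e R D \<and> (\<exists>\<^sub>\<infinity>L. q dvd A * b ^ L + D - r)"
proof -
  define M where "M = b ^ m"
  have q: "0 < q" "q < b * A" "A < q" and large: "b * (A * r + M) \<le> q * A"
    and nonsmooth: "\<And>j. \<not> A dvd b ^ j"
    and inf: "\<exists>\<^sub>\<infinity>L. q * A < b * ((A\<^sup>2 * b ^ L + e * M) mod (q * A))"
    using ext by (auto simp: extendable_def M_def)
  have "0 < b * A" using q by linarith
  then have "0 < A" using \<open>b \<ge> 2\<close> by (simp add: zero_less_mult_iff)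
  have "0 < M" using \<open>b \<ge> 2\<close> by (simp add: M_def)
  let ?R = "\<lambda>L. (A\<^sup>2 * b ^ L + e * M) mod (q * A)"
  have "0 < q * A" using q \<open>0 < A\<close> by simp
  have "finite (?R ` {L. q * A < b * ?R L})"
    by (rule finite_subset[of _ "{0..<q * A}"]) (use \<open>0 < q * A\<close> in auto)
  moreover have "infinite {L. q * A < b * ?R L}" using inf by (simp add: INFM_iff_infinite)
  ultimately obtain L0 where L0: "q * A < b * ?R L0"
    "infinite {L \<in> {L. q * A < b * ?R L}. ?R L = ?R L0}"
    using pigeonhole_infinite[of "{L. q * A < b * ?R L}" ?R] by auto
  define R where "R = ?R L0"
  have "infinite {L. ?R L = R}"
    using L0(2) by (rule infinite_super[rotated]) (auto simp: R_def)
  then have freq: "\<exists>\<^sub>\<infinity>L. q * A dvd A\<^sup>2 * b ^ L + e * M - R"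
    unfolding INFM_iff_infinite [symmetric]
  proof (rule frequently_elim1)
    fix L assume "?R L = R"
    then show "q * A dvd A\<^sup>2 * b ^ L + e * M - R"
      using dvd_minus_mod[of "q * A" "A\<^sup>2 * b ^ L + e * M"] by simp
  qed
  then obtain L1 where L1: "q * A dvd A\<^sup>2 * b ^ L1 + e * M - R" by (auto dest: frequently_ex)
  have "A dvd A\<^sup>2 * b ^ L1 + (e * M - R)" using dvd_mult_right[OF L1] by (simp add: algebra_simps)
  then have "A dvd e * M - R" by (simp add: dvd_add_right_iff power2_eq_square mult.assoc)
  then obtain D' where D': "e * M - R = A * D'" by (rule dvdE)
  define D where "D = D' + r"
  have AD: "A * D = A * r + e * M - R" using D' by (simp add: D_def algebra_simps)
  have R: "q * A < b * R" "R < q * A" using L0(1) \<open>0 < q * A\<close> by (simp_all add: R_def)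
  have bound: "b * (e * M) \<le> q * A" "b * (A * r + e * M) \<le> q * A"
  proof -
    have "e * M \<le> M" using e \<open>0 < M\<close> by auto
    then have "b * (e * M) \<le> b * M" "b * (A * r + e * M) \<le> b * (A * r + M)"
      using \<open>b \<ge> 2\<close> by (auto intro!: mult_left_mono)
    moreover have "b * M \<le> b * (A * r + M)" using \<open>b \<ge> 2\<close> \<open>0 \<le> r\<close> \<open>0 < A\<close> by (intro mult_left_mono) auto
    ultimately show "b * (e * M) \<le> q * A" "b * (A * r + e * M) \<le> q * A" using large by linarith+
  qed
  \<comment> \<open>\<open>D = 0\<close> and \<open>D = r\<close> mean
    \<open>R = A * r + e * M\<close> and \<open>R = e * M\<close>. The fourth conjunct of
    \<open>extendable\<close> makes both too small for \<open>q * A < b * R\<close>.\<close>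
  have "D \<noteq> 0"
  proof
    assume "D = 0"
    then have "R = A * r + e * M" using AD by simp
    then show False using bound(2) R(1) by simp
  qed
  have "D \<noteq> r"
  proof
    assume "D = r"
    then have "R = e * M" using AD by simp
    then show False using bound(1) R(1) by simp
  qed
  have nonterm: "\<not> q * A dvd R * b ^ j" for j
  proof
    assume "q * A dvd R * b ^ j"
    then have "A dvd R * b ^ j" by (rule dvd_mult_right)
    moreover have "R = e * M - A * D'" using D' by simp
    ultimately have "A dvd e * M * b ^ j - A * (D' * b ^ j)" by (simp add: algebra_simps)
    then have "A dvd (e * M * b ^ j - A * (D' * b ^ j)) + A * (D' * b ^ j)" by (rule dvd_add) simp
    then have "A dvd e * M * b ^ j" by simp
    then have "A dvd b ^ (m + j)" using e by (auto simp: M_def power_add)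
    then show False using nonsmooth by blast
  qed
  have "extension b A q r M e R D"
    by unfold_locales (use assms q R AD \<open>0 < A\<close> \<open>0 < M\<close> \<open>D \<noteq> 0\<close> \<open>D \<noteq> r\<close> nonterm in auto)
  moreover have "\<exists>\<^sub>\<infinity>L. q dvd A * b ^ L + D - r"
    using freq
  proof (rule frequently_elim1)
    fix L assume "q * A dvd A\<^sup>2 * b ^ L + e * M - R"
    also have "A\<^sup>2 * b ^ L + e * M - R = (A * b ^ L + D - r) * A"
      using D' by (simp add: D_def power2_eq_square algebra_simps)
    finally show "q dvd A * b ^ L + D - r" using \<open>0 < A\<close> by simp
  qed
  ultimately show ?thesis unfolding M_def by blast
qed

text \<open>Assuming \<open>extension\<close> instead of \<open>good\<close> allows starting from
  prefixes that are not good themselves.\<close>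

lemma extension_imp_good_snoc:
  assumes "2 \<le> b" "all_pos w"
    and ext: "extension b (excess b w) (den w) (prev_den w) (int b ^ length (digit_string b w)) ((- 1) ^ length w) R D"
    and freq: "\<exists>\<^sub>\<infinity>L. int (den w) dvd excess b w * int b ^ L + D - prev_den w"
  shows "\<exists>a\<ge>N. good b (w @ [a])"
proof -
  define A where "A = excess b w"
  define q r where "q = int (den w)" and "r = int (prev_den w)"
  define m where "m = length (digit_string b w)"
  define Y where "Y = int (digit_value b (digit_string b w))"
  define e :: int where "e = (- 1) ^ length w"
  have ext: "extension b A q r (int b ^ m) e R D"
    using ext unfolding A_def q_def r_def m_def e_def .
  note ev = extension.eventually_extendable[OF ext]
  obtain L0 where L0: "\<forall>L\<ge>L0. \<forall>a T. q * a = A * int b ^ L + D - r \<longrightarrow> q * T = int b ^ L * R - D * (D - r) \<longrightarrow>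
     int b ^ (L - 1) \<le> a \<and> a < int b ^ L \<and>
     extendable b T (A * int b ^ L + D) q (int b ^ m * int b ^ L) (- e)"
    using ev unfolding eventually_sequentially by blast
  obtain L where "L > max L0 N" and dvd: "q dvd A * int b ^ L + D - r"
    using freq unfolding INFM_nat A_def q_def r_def by blast
  then have L: "L0 \<le> L" "N < L" by auto
  obtain a' where a': "A * int b ^ L + D - r = q * a'" using dvd by (rule dvdE)
  define p p' where "p = int (num w)" and "p' = int (prev_num w)"
  have A: "A = int b ^ m * p - Y * q" unfolding A_def excess_def m_def p_def Y_def q_def by simp
  have det: "p' * q - p * r = e" unfolding p_def p'_def q_def r_def e_def by (rule convergents_det)
  \<comment> \<open>The excess of the new prefix, written out: \<open>L\<close> further digits turn
    \<open>Y\<close> into \<open>Y * b ^ L + a'\<close>, and the convergent is updated by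
    \<open>a'\<close>.\<close>
  define T where "T = int b ^ (m + L) * (a' * p + p') - (Y * int b ^ L + a') * (a' * q + r)"
  have qT: "q * T = int b ^ L * R - D * (D - r)"
  proof -
    define B M where "B = int b ^ L" and "M = int b ^ m"
    have AD: "A * D = A * r + e * M - R" using extension.AD[OF ext] unfolding M_def .
    have aq: "a' * q = A * B + D - r" using a' unfolding B_def by (simp add: mult.commute)
    have pM: "M * p = A + Y * q" using A unfolding M_def by simp
    \<comment> \<open>The determinant identity eliminates \<open>p'\<close>.\<close>
    have p'M: "q * (M * p') = A * r + Y * q * r + e * M"
    proof -
      have "q * (M * p') = M * (p' * q - p * r) + (M * p) * r" by (simp add: algebra_simps)
      then show ?thesis unfolding det pM by (simp add: algebra_simps)
    qed
    have T: "T = M * B * (a' * p + p') - (Y * B + a') * (a' * q + r)"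
      unfolding T_def power_add M_def B_def by (simp add: algebra_simps)
    have "q * T = B * ((a' * q) * (M * p) + q * (M * p')) - (Y * B * q + a' * q) * (a' * q + r)"
      unfolding T by (simp add: algebra_simps)
    also have "\<dots> = B * (A * r + e * M - A * D) - D * (D - r)"
      unfolding aq pM p'M by (simp add: algebra_simps)
    also have "A * r + e * M - A * D = R" using AD by simp
    finally show ?thesis unfolding B_def .
  qed
  have step: "int b ^ (L - 1) \<le> a'" "a' < int b ^ L"
    "extendable b T (A * int b ^ L + D) q (int b ^ m * int b ^ L) (- e)"
    using L0[rule_format, OF L(1) a' [symmetric] qT] by blast+
  have "0 < int b ^ (L - 1)" using assms(1) by simp
  then have "0 < a'" using step(1) by linarith
  define a where "a = nat a'"
  have a: "int a = a'" using \<open>0 < a'\<close> by (simp add: a_def)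
  have bounds: "b ^ (L - 1) \<le> a" "a < b ^ L" using step unfolding a [symmetric] by (simp_all flip: of_nat_power)
  have "Suc (L - 1) = L" using L(2) by simp
  then have len: "length (base_digits b a) = L"
    using length_base_digits[OF assms(1), of "L - 1" a] bounds by simp
  have "excess b (w @ [a]) = T"
    using digit_value_base_digits[OF assms(1), of a]
    by (simp add: excess_def T_def digit_value_append len m_def p_def p'_def q_def r_def Y_def flip: a)
  moreover have "int (den (w @ [a])) = A * int b ^ L + D"
    using a' by (simp add: a q_def r_def mult.commute)
  moreover have "int b ^ length (digit_string b (w @ [a])) = int b ^ m * int b ^ L"
    by (simp add: len m_def power_add)
  moreover have "0 < a" using \<open>0 < a'\<close> a by simp
  ultimately have "good b (w @ [a])"
    using step(3) assms(2) by (simp add: good_def q_def e_def del: digit_string_snoc convergents_snoc(1,2))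
  moreover have "N \<le> a"
  proof -
    have "N \<le> L - 1" using L(2) by simp
    also have "L - 1 < 2 ^ (L - 1)" by (rule less_exp)
    also have "(2::nat) ^ (L - 1) \<le> b ^ (L - 1)" using assms(1) by (rule power_mono) simp
    finally show ?thesis using bounds by simp
  qed
  ultimately show ?thesis by blast
qed

lemma good_snoc:
  assumes "2 \<le> b" "good b w"
  shows "\<exists>a\<ge>N. good b (w @ [a])"
proof -
  have e: "(- 1 :: int) ^ length w = 1 \<or> (- 1 :: int) ^ length w = - 1" by (cases "even (length w)") auto
  have "extendable b (excess b w) (den w) (prev_den w) (int b ^ length (digit_string b w)) ((- 1) ^ length w)"
    using assms(2) by (simp add: good_def)
  from extendable_imp_extension[OF this _ _ e] assms(1)
  obtain R D where
    "extension b (excess b w) (den w) (prev_den w) (int b ^ length (digit_string b w)) ((- 1) ^ length w) R D"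
    "\<exists>\<^sub>\<infinity>L. int (den w) dvd excess b w * int b ^ L + D - prev_den w"
    by auto
  then show ?thesis using assms by (intro extension_imp_good_snoc) (auto simp: good_def)
qed

lemma finite_cfrac_in_closed_digit_interval:
  assumes "2 \<le> b" "good b w"
  shows "finite_cfrac w \<in> closed_digit_interval b w"
proof -
  define k Y where "k = length (digit_string b w)" and "Y = digit_value b (digit_string b w)"
  have ext: "0 < int (den w)" "int (den w) < b * excess b w" "excess b w < den w"
    using assms(2) by (auto simp: good_def extendable_def)
  then have "0 < b * excess b w" by linarith
  then have "0 < excess b w" by (simp add: zero_less_mult_iff)
  then have "int (Y * den w) < int (b ^ k * num w)" "int (b ^ k * num w) < int ((Y + 1) * den w)"
    using ext by (simp_all add: excess_def k_def Y_def algebra_simps)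
  then have "real (Y * den w) < real (b ^ k * num w)" "real (b ^ k * num w) < real ((Y + 1) * den w)"
    by (simp_all only: of_nat_less_iff)
  then have "Y \<le> finite_cfrac w * real b ^ k" "finite_cfrac w * real b ^ k \<le> real Y + 1"
    using ext(1) assms(2) by (simp_all add: finite_cfrac_eq_convergent good_def field_simps)
  then show ?thesis by (simp add: closed_digit_interval_def k_def Y_def)
qed

lemma digit_value_less: "\<forall>d\<in>set ds. d < b \<Longrightarrow> digit_value b ds < b ^ length ds"
proof (induction ds rule: rev_induct)
  case (snoc d ds)
  then have "(digit_value b ds + 1) * b \<le> b ^ length ds * b" by (intro mult_le_mono1) simp
  then show ?case using snoc.prems by (simp add: mult.commute)
qed simp

text \<open>The digits of \<open>v\<close> have value at most \<open>b ^ l - 1\<close>, so the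
  intervals are nested.\<close>

lemma closed_digit_interval_append:
  assumes "2 \<le> b" "x \<in> closed_digit_interval b (w @ v)"
  shows "x \<in> closed_digit_interval b w"
proof -
  define k l where "k = length (digit_string b w)" and "l = length (digit_string b v)"
  define Y y where "Y = digit_value b (digit_string b w)" and "y = digit_value b (digit_string b v)"
  have b: "0 < real b ^ l" using assms(1) by simp
  have "y < b ^ l"
    unfolding y_def l_def by (rule digit_value_less) (auto simp: digit_string_def dest: base_digits_less)
  then have y: "real y + 1 \<le> real b ^ l" by (simp flip: of_nat_power)
  have "digit_string b (w @ v) = digit_string b w @ digit_string b v" by (simp add: digit_string_def)
  then have "real Y * real b ^ l + y \<le> x * real b ^ k * real b ^ l"
    "x * real b ^ k * real b ^ l \<le> real Y * real b ^ l + y + 1"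
    using assms(2)
    by (simp_all add: closed_digit_interval_def digit_value_append power_add mult.assoc k_def l_def Y_def y_def)
  then have "real Y * real b ^ l \<le> (x * real b ^ k) * real b ^ l"
    "(x * real b ^ k) * real b ^ l \<le> (real Y + 1) * real b ^ l"
    using y by (simp_all add: distrib_right)
  then have "real Y \<le> x * real b ^ k" "x * real b ^ k \<le> real Y + 1" using b by (simp_all del: distrib_right)
  then show ?thesis by (simp add: closed_digit_interval_def k_def Y_def)
qed

lemma closed_closed_digit_interval: "closed (closed_digit_interval b w)"
  unfolding closed_digit_interval_def
  by (intro closed_Collect_conj closed_Collect_le continuous_intros)

text \<open>Goodness is asked only from some length on, since initial segments of a good prefix may
  fail to be good.\<close>

definition good_numbers :: "nat \<Rightarrow> real set" where
  "good_numbers b = {x. \<exists>a m. has_infinite_cfrac x a \<and> (\<forall>n\<ge>m. good b (stake n a))}"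

text \<open>Late convergents lie in the closed digit intervals of their own prefixes, hence in those
  of all shorter ones, and so does the limit.\<close>

lemma good_numbers_subset_trott_numbers:
  assumes "2 \<le> b"
  shows "good_numbers b \<subseteq> trott_numbers b"
proof
  fix x assume "x \<in> good_numbers b"
  then obtain a m where a: "has_infinite_cfrac x a" "\<forall>n\<ge>m. good b (stake n a)"
    by (auto simp: good_numbers_def)
  have "x \<in> closed_digit_interval b (stake n a)" for n
  proof (rule Lim_in_closed_set[OF closed_closed_digit_interval])
    show "(\<lambda>n. finite_cfrac (stake n a)) \<longlonglongrightarrow> x" using a(1) by (simp add: has_infinite_cfrac_def)
    show "\<forall>\<^sub>F N in sequentially. finite_cfrac (stake N a) \<in> closed_digit_interval b (stake n a)"
    proof (rule eventually_sequentiallyI)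
      fix N assume N: "max m n \<le> N"
      then have "finite_cfrac (stake N a) \<in> closed_digit_interval b (stake N a)"
        using assms a(2) by (intro finite_cfrac_in_closed_digit_interval) auto
      then have "finite_cfrac (stake N a) \<in> closed_digit_interval b (stake n a @ stake (N - n) (sdrop n a))"
        using N by simp
      then show "finite_cfrac (stake N a) \<in> closed_digit_interval b (stake n a)"
        by (rule closed_digit_interval_append[OF assms])
    qed
  qed simp
  then show "x \<in> trott_numbers b" using a(1) trott_numbers_iff[OF assms] by blast
qed

lemma good_number_in_cylinder:
  assumes "2 \<le> b" "good b w"
  obtains x where "x \<in> good_numbers b" "x \<in> cylinder w"
proof -
  have "\<exists>a. good b (v @ [a])" if "good b v" for v using good_snoc[OF assms(1) that, of 0] by blast
  then obtain next_term where next_term: "\<And>v. good b v \<Longrightarrow> good b (v @ [next_term v])" by metis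
  define W where "W = rec_nat w (\<lambda>_ v. v @ [next_term v])"
  have W: "W 0 = w" "\<And>i. W (Suc i) = W i @ [next_term (W i)]" by (simp_all add: W_def)
  have good: "good b (W i)" for i by (induction i) (simp_all add: W assms(2) next_term)
  define a where "a = w @- smap (\<lambda>i. next_term (W i)) nats"
  have stake: "stake (length w + i) a = W i" for i
  proof (induction i)
    case (Suc i)
    have "a !! (length w + i) = next_term (W i)" by (simp add: a_def)
    then show ?case using Suc by (simp only: add_Suc_right stake_Suc W(2))
  qed (simp add: a_def W(1) stake_shift)
  have pos: "0 < a !! i" for i
  proof -
    have "all_pos (stake (length w + Suc i) a)" using good[of "Suc i"] unfolding stake good_def by blast
    moreover have "a !! i \<in> set (stake (length w + Suc i) a)"
      unfolding in_set_conv_nth by (intro exI[of _ i]) (simp del: stake.simps(2))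
    ultimately show ?thesis by blast
  qed
  then obtain x where x: "has_infinite_cfrac x a" using infinite_cfrac_converges by blast
  have "good b (stake n a)" if "length w \<le> n" for n
    using good[of "n - length w"] stake[of "n - length w"] that by simp
  then have "x \<in> good_numbers b" using x unfolding good_numbers_def by blast
  moreover have "x \<in> cylinder w"
  proof -
    have "x \<in> cylinder (stake (length w + 0) a)" using x unfolding has_infinite_cfrac_iff by blast
    then show ?thesis unfolding stake W(1) .
  qed
  ultimately show thesis by (rule that)
qed

text \<open>A good number in the cylinder of \<open>w @ [a]\<close> is within \<open>1 / a\<close>
  of the convergent, and \<open>a\<close> can be arbitrarily large.\<close>

lemma finite_cfrac_in_closure_good_numbers:
  assumes "2 \<le> b" "good b w"
  shows "finite_cfrac w \<in> closure (good_numbers b)"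
  unfolding closure_approachable
proof (intro allI impI)
  fix \<epsilon> :: real assume "0 < \<epsilon>"
  obtain N where N: "1 / \<epsilon> < real N" using reals_Archimedean2[of "1 / \<epsilon>"] by auto
  moreover have "0 < 1 / \<epsilon>" using \<open>0 < \<epsilon>\<close> by simp
  ultimately have "0 < real N" by linarith
  then have "1 / real N < \<epsilon>" using N \<open>0 < \<epsilon>\<close> by (simp add: field_simps)
  obtain a where a: "N \<le> a" "good b (w @ [a])" using good_snoc[OF assms] by blast
  obtain x where x: "x \<in> good_numbers b" "x \<in> cylinder (w @ [a])"
    using good_number_in_cylinder[OF assms(1) a(2)] by metis
  obtain z where z: "0 < z" "z < 1" "x = cfrac_with_tail (w @ [a]) z"
    using cylinder_imp_cfrac_with_tail[OF x(2)] by auto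
  have "x = cfrac_with_tail w (1 / (a + z))" using z(3) by (simp add: cfrac_with_tail_append)
  then have "\<bar>x - finite_cfrac w\<bar> \<le> 1 / (a + z)"
    using z(1) assms(2) cfrac_with_tail_dist_le_tail[of w "1 / (a + z)"] by (simp add: good_def)
  also have "real N \<le> a + z" using a(1) z(1) by simp
  then have "1 / (a + z) \<le> 1 / real N" using \<open>0 < real N\<close> by (intro frac_le) simp_all
  also note \<open>1 / real N < \<epsilon>\<close>
  finally show "\<exists>x\<in>good_numbers b. dist x (finite_cfrac w) < \<epsilon>"
    using x(1) by (auto simp: dist_real_def)
qed

lemma finite_cfrac_not_trott:
  assumes "2 \<le> b" "all_pos w"
  shows "finite_cfrac w \<notin> trott_numbers b"
proof
  assume "finite_cfrac w \<in> trott_numbers b"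
  then obtain a where "has_infinite_cfrac (finite_cfrac w) a" using trott_numbers_iff[OF assms(1)] by blast
  then have "finite_cfrac w \<notin> \<rat>" by (rule has_infinite_cfrac_irrational)
  then show False using finite_cfrac_eq_convergent[OF assms(2)] by simp
qed

text \<open>The late convergents of a good number lie in the closure, are rational and thus not
  Trott, and converge to it.\<close>

lemma good_numbers_subset_closure_complement:
  assumes "2 \<le> b"
  shows "good_numbers b \<subseteq> closure (closure (good_numbers b) - trott_numbers b)"
proof
  fix x assume "x \<in> good_numbers b"
  then obtain a m where a: "has_infinite_cfrac x a" "\<forall>n\<ge>m. good b (stake n a)"
    by (auto simp: good_numbers_def)
  show "x \<in> closure (closure (good_numbers b) - trott_numbers b)"
  proof (rule Lim_in_closed_set[OF closed_closure])
    show "(\<lambda>n. finite_cfrac (stake n a)) \<longlonglongrightarrow> x" using a(1) by (simp add: has_infinite_cfrac_def)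
    show "\<forall>\<^sub>F n in sequentially. finite_cfrac (stake n a) \<in>
        closure (closure (good_numbers b) - trott_numbers b)"
    proof (rule eventually_sequentiallyI)
      fix n assume "m \<le> n"
      then have "good b (stake n a)" using a(2) by blast
      then have "finite_cfrac (stake n a) \<in> closure (good_numbers b) - trott_numbers b"
        using finite_cfrac_in_closure_good_numbers[OF assms, of "stake n a"]
          finite_cfrac_not_trott[OF assms, of "stake n a"] unfolding good_def by blast
      then show "finite_cfrac (stake n a) \<in> closure (closure (good_numbers b) - trott_numbers b)"
        by (rule subsetD[OF closure_subset])
    qed
  qed simp
qed

section \<open>Starting prefixes\<close>

text \<open>The prefix \<open>[k]\<close> has convergent \<open>1 / k\<close> and the single digit
  \<open>k\<close>, so its excess is \<open>b - k\<^sup>2 = r\<close>. As \<open>e = - 1\<close> and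
  \<open>D < 0\<close>, \<open>e * D > 0\<close> covers terminating expansions and
  \<open>R = q * A\<close>, while \<open>D < 1\<close> covers \<open>A = q\<close>, that is,
  \<open>b = k\<^sup>2 + k\<close>.\<close>

lemma ex_good_square_plus:
  assumes b: "b = k\<^sup>2 + r" and "1 \<le> r" "r \<le> k"
  shows "\<exists>w. good b w"
proof -
  have "1 \<le> k" using assms by linarith
  then have "1 \<le> k\<^sup>2" "k \<le> k\<^sup>2" by (simp_all add: power2_eq_square)
  then have "2 \<le> b" "k < b" using assms by linarith+
  have "length (base_digits b k) = Suc 0"
    using \<open>2 \<le> b\<close> \<open>1 \<le> k\<close> \<open>k < b\<close> by (intro length_base_digits) simp_all
  then have w: "num [k] = 1" "den [k] = k" "prev_den [k] = 1" "length (digit_string b [k]) = 1"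
    "digit_value b (digit_string b [k]) = k"
    using convergents_snoc[of "[]" k] digit_string_snoc[of b "[]" k] digit_value_base_digits[OF \<open>2 \<le> b\<close>, of k]
    by (simp_all add: digit_string_def)
  have excess: "excess b [k] = r" unfolding excess_def w by (simp add: b power2_eq_square)
  define A q where "A = int r" and "q = int k"
  have A: "0 < A" "A \<le> q" using assms by (simp_all add: A_def q_def)
  have int_b: "int b = q\<^sup>2 + A" by (simp add: b A_def q_def)
  \<comment> \<open>The residue is taken in \<open>{1..q A}\<close>: for \<open>b = k\<^sup>2 + 1\<close> the usual one would be \<open>0\<close>.\<close>
  let ?R = "\<lambda>L. (A\<^sup>2 * int b ^ L - b - 1) mod (q * A) + 1"
  have "0 < q * A" using A by simp
  have "finite (?R ` UNIV)"
    by (rule finite_subset[of _ "{1..q * A}"]) (use \<open>0 < q * A\<close> in \<open>auto simp: add1_zle_eq\<close>)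
  then obtain L0 where L0: "infinite {L \<in> UNIV. ?R L = ?R L0}"
    using pigeonhole_infinite[of "UNIV :: nat set" ?R] by auto
  define R where "R = ?R L0"
  have R: "1 \<le> R" "R \<le> q * A" using \<open>0 < q * A\<close> by (auto simp: R_def add1_zle_eq)
  have "\<exists>\<^sub>\<infinity>L. ?R L = R" using L0 by (simp add: INFM_iff_infinite R_def)
  then have freq: "\<exists>\<^sub>\<infinity>L. q * A dvd A\<^sup>2 * int b ^ L - b - R"
  proof (rule frequently_elim1)
    fix L assume "?R L = R"
    then have "A\<^sup>2 * int b ^ L - b - R = (A\<^sup>2 * int b ^ L - b - 1) - (A\<^sup>2 * int b ^ L - b - 1) mod (q * A)"
      by linarith
    also have "q * A dvd \<dots>" by (rule dvd_minus_mod)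
    finally show "q * A dvd A\<^sup>2 * int b ^ L - b - R" .
  qed
  then obtain L1 where L1: "q * A dvd A\<^sup>2 * int b ^ L1 - b - R" by (auto dest: frequently_ex)
  have "A dvd A\<^sup>2 * int b ^ L1 + (- b - R)" using dvd_mult_right[OF L1] by (simp add: algebra_simps)
  then have "A dvd - b - R" by (simp add: dvd_add_right_iff power2_eq_square mult.assoc)
  then obtain D' where D': "- int b - R = A * D'" by (rule dvdE)
  define D where "D = D' + 1"
  have AD: "A * D = A - b - R" using D' by (simp add: D_def algebra_simps)
  have "0 \<le> q\<^sup>2" by simp
  then have "A * D < 0" using R int_b unfolding AD by linarith
  then have "D < 0" using A by (simp add: mult_less_0_iff)
  have "q * A \<le> q\<^sup>2" using A by (simp add: power2_eq_square)
  then have "q * A < int b" using int_b A by linarith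
  also have "int b * 1 \<le> int b * R" using R by (intro mult_left_mono) auto
  finally have bR: "q * A < int b * R" by simp
  have "q < int b * A"
  proof -
    have "int b * 1 \<le> int b * A" using A by (intro mult_left_mono) auto
    then show ?thesis using \<open>k < b\<close> unfolding q_def by linarith
  qed
  have ext: "extension b A q 1 b (- 1) R D"
    by unfold_locales (use \<open>2 \<le> b\<close> A R AD \<open>D < 0\<close> bR \<open>q < int b * A\<close> in auto)
  have freq': "\<exists>\<^sub>\<infinity>L. q dvd A * int b ^ L + D - 1"
    using freq
  proof (rule frequently_elim1)
    fix L assume "q * A dvd A\<^sup>2 * int b ^ L - b - R"
    also have "A\<^sup>2 * int b ^ L - b - R = (A * int b ^ L + D - 1) * A"
      using D' by (simp add: D_def power2_eq_square algebra_simps)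
    finally show "q dvd A * int b ^ L + D - 1" using A by simp
  qed
  have "\<exists>a\<ge>0. good b ([k] @ [a])"
    by (rule extension_imp_good_snoc[where R = R and D = D])
      (use ext freq' \<open>1 \<le> k\<close> \<open>2 \<le> b\<close> in \<open>simp_all add: w excess A_def q_def\<close>)
  then show ?thesis by blast
qed

text \<open>The prefix \<open>[1, 1]\<close> has convergent \<open>1 / 2\<close> and digit value
  \<open>4\<close>, so its excess is \<open>9 - 8 = 1\<close>. The residue
  \<open>(3 ^ L + 9) mod 2 = 0\<close> is replaced by \<open>R = q * A = 2\<close>, which gives
  \<open>D = 1 + 9 - 2 = 8\<close> and \<open>e * D > 0\<close>.\<close>

lemma ex_good_3: "\<exists>w. good 3 w"
proof -
  have "length (base_digits 3 1) = Suc 0" by (rule length_base_digits) simp_all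
  then have "base_digits 3 1 = [1]"
    using digit_value_base_digits[of 3 1] by (cases "base_digits 3 1") (auto simp: digit_value_def)
  then have ds: "digit_string 3 [1, 1] = [1, 1]" by (simp add: digit_string_def)
  have w: "num [1, 1] = 1" "den [1, 1] = 2" "prev_den [1, 1] = 1"
    by (simp_all add: convergent_defs)
  have excess: "excess 3 [1, 1] = 1"
    by (simp add: excess_def ds w digit_value_def flip: One_nat_def)
  have "\<exists>a\<ge>0. good 3 ([1, 1] @ [a])"
  proof (rule extension_imp_good_snoc)
    have "extension 3 1 2 1 9 1 2 8" by unfold_locales auto
    then show "extension (int 3) (excess 3 [1, 1]) (den [1, 1]) (prev_den [1, 1])
        (int 3 ^ length (digit_string 3 [1, 1])) ((- 1) ^ length [1, 1 :: nat]) 2 8"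
      unfolding excess ds w by simp
    show "\<exists>\<^sub>\<infinity>L. int (den [1, 1]) dvd excess 3 [1, 1] * int 3 ^ L + 8 - int (prev_den [1, 1])"
      unfolding excess w by (simp add: frequently_const_iff)
  qed simp_all
  then show ?thesis by blast
qed

section \<open>The Baire category argument\<close>

text \<open>Baire's theorem in \<open>K = closure T\<close>: the sets \<open>K \<inter> U n\<close>
  contain \<open>T\<close> and the sets \<open>K - F n\<close> contain \<open>K - S\<close>, so all
  are open and dense in \<open>K\<close>, yet no point lies in all of them.\<close>

lemma gdelta_not_fsigma_if_codense:
  fixes S T :: "real set"
  assumes "gdelta S" "T \<subseteq> S" "T \<noteq> {}" and codense: "T \<subseteq> closure (closure T - S)"
  shows "\<not> fsigma S"
proof
  assume "fsigma S"
  then obtain F :: "nat \<Rightarrow> real set" where F: "\<And>n. closed (F n)" "S = (\<Union>n. F n)"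
    by (auto elim!: fsigma.cases)
  obtain U :: "nat \<Rightarrow> real set" where U: "\<And>n. open (U n)" "S = (\<Inter>n. U n)"
    using \<open>gdelta S\<close> by (auto elim!: gdelta.cases)
  define K where "K = closure T"
  let ?G = "range (\<lambda>n. K \<inter> U n) \<union> range (\<lambda>n. K - F n)"
  have "K \<subseteq> closure (\<Inter>?G)"
  proof (rule Baire)
    show "closed K" by (simp add: K_def)
    show "countable ?G" by simp
    fix V assume "V \<in> ?G"
    then consider n where "V = K \<inter> U n" | n where "V = K - F n" by blast
    then show "openin (top_of_set K) V \<and> K \<subseteq> closure V"
    proof cases
      case 1
      have "T \<subseteq> V" using assms(2) U(2) closure_subset unfolding 1 K_def by blast
      then have "K \<subseteq> closure V" unfolding K_def by (rule closure_mono)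
      then show ?thesis using U(1) unfolding 1 by (simp add: openin_open_Int)
    next
      case 2
      have "V = K \<inter> - F n" using 2 by blast
      then have "openin (top_of_set K) V" using F(1) by (simp add: openin_open_Int open_Compl)
      moreover have "K - S \<subseteq> V" using F(2) unfolding 2 by blast
      then have "closure (K - S) \<subseteq> closure V" by (rule closure_mono)
      then have "T \<subseteq> closure V" using codense unfolding K_def by blast
      then have "K \<subseteq> closure V" unfolding K_def by (intro closure_minimal) auto
      ultimately show ?thesis by blast
    qed
  qed
  moreover have "\<Inter>?G = {}" using F(2) U(2) by blast
  ultimately have "K = {}" by simp
  then show False using \<open>T \<noteq> {}\<close> closure_subset unfolding K_def by blast
qed

theorem theorem1p3:
  fixes b :: nat
  assumes "b \<in> trott_bases"
  shows "gdelta (trott_numbers b) \<and> \<not> fsigma (trott_numbers b)"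
proof -
  have "2 \<le> b \<and> (\<exists>w. good b w)"
  proof (cases "b = 3")
    case False
    then obtain k where k: "1 \<le> k" "k\<^sup>2 + 1 \<le> b" "b \<le> k\<^sup>2 + k" using assms by (auto simp: trott_bases_def)
    moreover from this have "1 \<le> k\<^sup>2" by simp
    ultimately have "2 \<le> b" "b = k\<^sup>2 + (b - k\<^sup>2)" "1 \<le> b - k\<^sup>2" "b - k\<^sup>2 \<le> k" by linarith+
    then show ?thesis using ex_good_square_plus by blast
  qed (use ex_good_3 in simp)
  then obtain w where b: "2 \<le> b" and w: "good b w" by blast
  have "good_numbers b \<noteq> {}" using good_number_in_cylinder[OF b w] by blast
  then show ?thesis
    using gdelta_trott_numbers[OF b] good_numbers_subset_trott_numbers[OF b]
      good_numbers_subset_closure_complement[OF b] gdelta_not_fsigma_if_codense by blast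
qed

end
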